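(* Let $G$ be a bipartite graph, arriving online with one-sided node arrivals, with $n$ offline nodes and maximum degree $\Delta(G)\le \Delta$, where $\Delta\ge 32\ln n$. Then running Algorithm 1 with parameter $\Delta$ on $G$ yields a feasible (proper) edge-coloring of some subgraph $H\subseteq G$ using $\Delta(1+\sqrt{\varepsilon})$ colors, where $\varepsilon=2\sqrt[5]{\ln n/\Delta}$, such that with probability at least $1-n^{-5}$ the uncolored subgraph satisfies $\Delta(G\setminus H)\le (e^{-1}+3\sqrt{\varepsilon})\Delta$. This guarantee holds even against an adaptive adversary.
   Context: Setting: a bipartite graph with $n$ offline nodes known in advance and $n$ online nodes $v_1,\dots,v_n$; at time $t$ the node $v_t$ arrives with all its edges to its offline neighbors $N(v_t)$, and edges must be colored (or left uncolored) immediately and irrevocably, with no two edges sharing an endpoint receiving the same color. An adaptive adversary chooses each arriving node's neighborhood as a function of the algorithm's random choices so far (subject to the maximum degree bound). Contention resolution scheme (CRS): a randomized procedure $\mathrm{CRS}(R,\vec x)$ which, given a random set $R\subseteq[k]$ drawn from a product distribution with marginals $x_1,\dots,x_k$, outputs $O\subseteq R$ with $|O|=1$ whenever $R\neq\emptyset$ (and $O=\emptyset$ otherwise), such that $\Pr[i\in O]\ge x_i\cdot \frac{1-\prod_{j}(1-x_j)}{\sum_j x_j}$ for all $i$. Algorithm 1 (Partial Edge Coloring) with input parameter $\Delta$: set $\varepsilon=2\sqrt[5]{\ln n/\Delta}$ and $\mathcal C=\{1,\dots,\lceil(1+\sqrt{\varepsilon})\Delta\rceil\}$; every offline node $u$ gets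 palette $P(u)\gets\mathcal C$. When $v_t$ arrives: for every color $c\in\mathcal C$ and $u\in N(v_t)$ set $x^{(t)}_{uc}=\mathbb{1}[c\in P(u)]/|P(u)|$ (with $P(u)$ the current palette). Then for each edge $e=(u,v_t)$, independently pick a color $c(e)\in P(u)$ uniformly at random and remove $c(e)$ from $P(u)$. Then for each color $c\in\mathcal C$, let $R_c=\{e=(u,v_t): c(e)=c\}$, let $\vec x_c=(x^{(t)}_{uc})_{u\in N(v_t)}$, set $S_c\gets\mathrm{CRS}(R_c,\vec x_c)$, and if $S_c\ne\emptyset$ assign color $c$ to the unique edge in $S_c$. Edges not assigned a color remain uncolored. $H$ denotes the subgraph of colored edges, and $\Delta(\cdot)$ denotes maximum degree. *)

theory Defs
  imports "HOL-Probability.Product_PMF"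
begin

definition product_set_pmf :: "'i set \<Rightarrow> ('i \<Rightarrow> real) \<Rightarrow> 'i set pmf" where
  "product_set_pmf I x =
     map_pmf (\<lambda>b. {i \<in> I. b i}) (Pi_pmf I False (\<lambda>i. bernoulli_pmf (x i)))"

text \<open>A randomized procedure is represented by the distribution \<open>crs I x R\<close> of its output, where
  \<open>I\<close> is the ground set, \<open>x\<close> the vector of marginals on \<open>I\<close> and \<open>R\<close> the realized set.
  The quotient is \<open>0\<close> when all marginals vanish.\<close>

definition contention_resolution_scheme ::
    "('i set \<Rightarrow> ('i \<Rightarrow> real) \<Rightarrow> 'i set \<Rightarrow> 'i set pmf) \<Rightarrow> bool" where
  "contention_resolution_scheme crs \<longleftrightarrow>
     (\<forall>I x. finite I \<longrightarrow> (\<forall>i\<in>I. 0 \<le> x i \<and> x i \<le> 1) \<longrightarrow>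
        (\<forall>R \<in> set_pmf (product_set_pmf I x). \<forall>S \<in> set_pmf (crs I x R).
            S \<subseteq> R \<and> (R \<noteq> {} \<longrightarrow> card S = 1)) \<and>
        (\<forall>i\<in>I. measure_pmf.prob (bind_pmf (product_set_pmf I x) (crs I x)) {S. i \<in> S}
            \<ge> x i * ((1 - (\<Prod>j\<in>I. 1 - x j)) / (\<Sum>j\<in>I. x j))))"

text \<open>Offline nodes have type \<open>'u\<close>, the online node \<open>v\<^sub>t\<close> is the number \<open>t \<ge> 1\<close>, and colors are
  positive integers. The record of one arrival is the triple \<open>(N, c, S)\<close> of the neighborhood of the
  arriving node, the color \<open>c u\<close> picked for the edge from each \<open>u \<in> N\<close>, and the output \<open>S k\<close> of the
  contention resolution scheme for each color \<open>k\<close>; edges at the arriving node are identified with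
  their offline endpoints. A history lists the arrivals with the latest one first, so the
  head of \<open>r # h\<close> is the arrival of the online node \<open>Suc (length h)\<close>.\<close>

type_synonym 'u arrival = "'u set \<times> ('u \<Rightarrow> nat) \<times> (nat \<Rightarrow> 'u set)"
type_synonym 'u history = "'u arrival list"

fun palette :: "nat set \<Rightarrow> 'u history \<Rightarrow> 'u \<Rightarrow> nat set" where
  "palette C [] u = C"
| "palette C ((N, c, S) # h) u = (if u \<in> N then palette C h u - {c u} else palette C h u)"

fun graph_edges :: "'u history \<Rightarrow> ('u \<times> nat) set" where
  "graph_edges [] = {}"
| "graph_edges ((N, c, S) # h) = graph_edges h \<union> N \<times> {Suc (length h)}"

text \<open>The color assignment is kept as a relation between edges and colors; that no edge
  receives two colors is part of \<open>proper_partial_edge_coloring\<close> below.\<close>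

fun color_assignment :: "'u history \<Rightarrow> (('u \<times> nat) \<times> nat) set" where
  "color_assignment [] = {}"
| "color_assignment ((N, c, S) # h) =
     color_assignment h \<union> {((u, Suc (length h)), k) |u k. u \<in> S k}"

definition colored_edges :: "'u history \<Rightarrow> ('u \<times> nat) set" where
  "colored_edges h = Domain (color_assignment h)"

definition marginal :: "nat set \<Rightarrow> 'u history \<Rightarrow> nat \<Rightarrow> 'u \<Rightarrow> real" where
  "marginal C h k u = of_bool (k \<in> palette C h u) / real (card (palette C h u))"

text \<open>The adversary \<open>adv\<close> chooses the next neighborhood from the entire history.\<close>

definition process_arrival ::
    "('u set \<Rightarrow> ('u \<Rightarrow> real) \<Rightarrow> 'u set \<Rightarrow> 'u set pmf) \<Rightarrow> nat set \<Rightarrow> ('u history \<Rightarrow> 'u set) \<Rightarrow>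
      'u history \<Rightarrow> 'u history pmf" where
  "process_arrival crs C adv h =
     (let N = adv h in
        bind_pmf (Pi_pmf N 0 (\<lambda>u. pmf_of_set (palette C h u)))
          (\<lambda>c. bind_pmf (Pi_pmf C {} (\<lambda>k. crs N (marginal C h k) {u \<in> N. c u = k}))
            (\<lambda>S. return_pmf ((N, c, S) # h))))"

primrec run_arrivals ::
    "('u set \<Rightarrow> ('u \<Rightarrow> real) \<Rightarrow> 'u set \<Rightarrow> 'u set pmf) \<Rightarrow> nat set \<Rightarrow> ('u history \<Rightarrow> 'u set) \<Rightarrow>
      nat \<Rightarrow> 'u history pmf" where
  "run_arrivals crs C adv 0 = return_pmf []"
| "run_arrivals crs C adv (Suc t) =
     bind_pmf (run_arrivals crs C adv t) (process_arrival crs C adv)"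

definition eps :: "nat \<Rightarrow> real \<Rightarrow> real" where
  "eps n \<Delta> = 2 * root 5 (ln (real n) / \<Delta>)"

definition color_set :: "nat \<Rightarrow> real \<Rightarrow> nat set" where
  "color_set n \<Delta> = {1..nat \<lceil>(1 + sqrt (eps n \<Delta>)) * \<Delta>\<rceil>}"

definition partial_edge_coloring_alg ::
    "('u set \<Rightarrow> ('u \<Rightarrow> real) \<Rightarrow> 'u set \<Rightarrow> 'u set pmf) \<Rightarrow> nat \<Rightarrow> real \<Rightarrow> ('u history \<Rightarrow> 'u set) \<Rightarrow>
      'u history pmf" where
  "partial_edge_coloring_alg crs n \<Delta> adv = run_arrivals crs (color_set n \<Delta>) adv n"

definition max_degree :: "'u set \<Rightarrow> nat \<Rightarrow> ('u \<times> nat) set \<Rightarrow> nat" where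
  "max_degree U n E =
     Max ({0} \<union> (\<lambda>u. card {t. (u, t) \<in> E}) ` U \<union> (\<lambda>t. card {u. (u, t) \<in> E}) ` {1..n})"

definition proper_partial_edge_coloring ::
    "('u \<times> nat) set \<Rightarrow> nat set \<Rightarrow> (('u \<times> nat) \<times> nat) set \<Rightarrow> bool" where
  "proper_partial_edge_coloring E C F \<longleftrightarrow>
     single_valued F \<and> Domain F \<subseteq> E \<and> Range F \<subseteq> C \<and>
     (\<forall>(e, k) \<in> F. \<forall>(e', k') \<in> F.
        e \<noteq> e' \<and> (fst e = fst e' \<or> snd e = snd e') \<longrightarrow> k \<noteq> k')"

end

theory Submission
  imports Defs "HOL-Probability.Hoeffding"
begin

text \<open>
  Write \<open>x\<^sub>u\<^sub>k\<close> for the current marginal of color \<open>k\<close> at \<open>u\<close>. Removing a uniformly random color from the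
  palette leaves the expectation of \<open>x\<^sub>u\<^sub>k\<close> unchanged, so for fixed sets \<open>N\<close> of at most \<open>\<Delta>\<close> offline nodes
  and \<open>K\<close> of \<open>m\<close> colors the total load \<open>\<Sum>u\<in>N. \<Sum>k\<in>K. x\<^sub>u\<^sub>k\<close> is a martingale with initial value at most
  \<open>m / (1 + \<surd>\<epsilon>)\<close>. By an Azuma bound it is very unlikely to reach \<open>m\<close>, and for \<open>m \<approx> \<epsilon>\<Delta>\<close> a union bound
  over all \<open>N\<close> and \<open>K\<close> is affordable. Hence, whatever neighborhood an adaptive adversary chooses,
  fewer than \<open>m\<close> colors have load above 1. Every other color in the palette of \<open>u\<close> survives
  contention resolution with probability at least \<open>1 - 1/e\<close>, and palettes always keep \<open>\<surd>\<epsilon>\<Delta>\<close> colors,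
  so each edge is uncolored with conditional probability at most \<open>1/e + 2\<surd>\<epsilon>\<close>. Concentration of
  the uncolored degree costs another \<open>\<surd>\<epsilon>\<Delta>\<close>: at an offline node by Azuma's inequality over time, at
  an online node by bounded differences, since its number of colored edges is the number of
  distinct colors picked.
\<close>

section \<open>Exponential moments and contention resolution\<close>

text \<open>Hoeffding's lemma with the mean moved to the right-hand side. Integrals in
  \<open>ennreal\<close> let such bounds be iterated over arrivals without integrability
  conditions.\<close>

lemma nn_integral_exp_le_Hoeffding:
  fixes M :: "'a pmf" and f :: "'a \<Rightarrow> real"
  assumes range: "\<And>x. x \<in> set_pmf M \<Longrightarrow> f x \<in> {a..b}" and s: "0 < s"
  shows "(\<integral>\<^sup>+x. ennreal (exp (s * f x)) \<partial>M)
           \<le> ennreal (exp (s * measure_pmf.expectation M f + s\<^sup>2 * (b - a)\<^sup>2 / 8))"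
proof -
  interpret B: interval_bounded_random_variable "measure_pmf M" f a b
  proof unfold_locales
    show "AE x in measure_pmf M. f x \<in> {a..b}"
      using range by (simp add: AE_measure_pmf_iff)
  qed simp
  let ?m = "measure_pmf.expectation M f"
  have "(\<integral>\<^sup>+x. ennreal (exp (s * f x)) \<partial>M)
      = (\<integral>\<^sup>+x. ennreal (exp (s * ?m)) * ennreal (exp (s * (f x - ?m))) \<partial>M)"
    by (simp add: ring_distribs flip: ennreal_mult exp_add)
  also have "\<dots> = ennreal (exp (s * ?m)) * (\<integral>\<^sup>+x. ennreal (exp (s * (f x - ?m))) \<partial>M)"
    by (rule nn_integral_cmult) simp
  also have "\<dots> \<le> ennreal (exp (s * ?m)) * ennreal (exp (s\<^sup>2 * (b - a)\<^sup>2 / 8))"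
    using B.Hoeffdings_lemma_nn_integral[OF s] by (intro mult_left_mono) simp_all
  also have "\<dots> = ennreal (exp (s * ?m + s\<^sup>2 * (b - a)\<^sup>2 / 8))"
    by (simp add: exp_add ennreal_mult)
  finally show ?thesis .
qed

text \<open>Markov's inequality, the last step of every Chernoff bound below. The lower bound on
  \<open>F\<close> is only asked for on \<open>A\<close>, so \<open>F\<close> may be a potential
  that vanishes elsewhere.\<close>

lemma prob_le_exp_Markov:
  fixes M :: "'a pmf" and F :: "'a \<Rightarrow> ennreal"
  assumes "\<And>x. x \<in> set_pmf M \<Longrightarrow> x \<in> A \<Longrightarrow> ennreal (exp a) \<le> F x"
    and "(\<integral>\<^sup>+x. F x \<partial>M) \<le> ennreal (exp b)"
  shows "measure_pmf.prob M A \<le> exp (b - a)"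
proof -
  have "ennreal (exp a) * emeasure M A = (\<integral>\<^sup>+x. ennreal (exp a) * indicator A x \<partial>M)"
    by (simp add: nn_integral_cmult_indicator)
  also have "\<dots> \<le> (\<integral>\<^sup>+x. F x \<partial>M)"
    using assms(1) by (intro nn_integral_mono_AE) (auto simp: AE_measure_pmf_iff indicator_def)
  also note assms(2)
  finally have "ennreal (exp a * measure_pmf.prob M A) \<le> ennreal (exp b)"
    by (simp add: measure_pmf.emeasure_eq_measure ennreal_mult)
  then have "exp a * measure_pmf.prob M A \<le> exp b"
    by (subst (asm) ennreal_le_iff) simp_all
  then show ?thesis by (simp add: exp_diff field_simps)
qed

text \<open>McDiarmid's inequality in moment form: the coordinates are exposed one at a time, and
  each moves the conditional mean within an interval of length 1, which costs
  \<open>s\<^sup>2 / 8\<close> by Hoeffding's lemma.\<close>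

lemma nn_integral_exp_le_bounded_differences:
  fixes p :: "'i \<Rightarrow> 'b pmf" and f :: "('i \<Rightarrow> 'b) \<Rightarrow> real"
  assumes "finite A" and "\<And>x. x \<in> A \<Longrightarrow> finite (set_pmf (p x))"
    and "\<And>g x y z. x \<in> A \<Longrightarrow> f (g(x := y)) \<le> f (g(x := z)) + 1" and s: "0 < s"
  shows "(\<integral>\<^sup>+g. ennreal (exp (s * f g)) \<partial>Pi_pmf A d p)
           \<le> ennreal (exp (s * measure_pmf.expectation (Pi_pmf A d p) f + s\<^sup>2 * real (card A) / 8))"
  using assms(1-3)
proof (induction A arbitrary: f rule: finite_induct)
  case empty
  then show ?case by simp
next
  case (insert x A)
  let ?P = "Pi_pmf A d p"
  define m where "m y = measure_pmf.expectation ?P (\<lambda>g. f (g(x := y)))" for y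
  have finP: "finite (set_pmf ?P)"
    using insert.prems(1) insert.hyps by (auto simp: set_Pi_pmf intro!: finite_PiE_dflt)
  have finx: "finite (set_pmf (p x))" using insert.prems(1) by simp
  have mdiff: "m y \<le> m z + 1" for y z
  proof -
    have "m y \<le> measure_pmf.expectation ?P (\<lambda>g. f (g(x := z)) + 1)"
      unfolding m_def using finP
      by (intro integral_mono integrable_measure_pmf_finite insert.prems(2)) simp_all
    also have "\<dots> = m z + 1"
      unfolding m_def using finP by (simp add: integrable_measure_pmf_finite)
    finally show ?thesis .
  qed
  \<comment> \<open>The one-sided bound \<open>mdiff\<close>, valid for all pairs, confines the
    conditional means to an interval of length 1 that starts at the smallest of them.\<close>
  define a where "a = Min (m ` set_pmf (p x))"
  have mrange: "m y \<in> {a..a + 1}" if "y \<in> set_pmf (p x)" for y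
  proof -
    have "a \<in> m ` set_pmf (p x)"
      unfolding a_def using finx set_pmf_not_empty by (intro Min_in) auto
    then obtain z where "a = m z" by auto
    moreover have "a \<le> m y"
      unfolding a_def using finx that by simp
    ultimately show ?thesis using mdiff[of y z] by simp
  qed
  have mexp: "measure_pmf.expectation (Pi_pmf (insert x A) d p) f = measure_pmf.expectation (p x) m"
    unfolding Pi_pmf_insert'[OF insert.hyps]
    using finP by (subst pmf_expectation_bind[OF finx])
      (simp_all add: integral_measure_pmf[OF finx] m_def flip: map_pmf_def)
  have "(\<integral>\<^sup>+g. ennreal (exp (s * f g)) \<partial>Pi_pmf (insert x A) d p)
      = (\<integral>\<^sup>+y. \<integral>\<^sup>+g. ennreal (exp (s * f (g(x := y)))) \<partial>?P \<partial>p x)"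
    by (simp add: Pi_pmf_insert'[OF insert.hyps])
  also have "\<dots> \<le> (\<integral>\<^sup>+y. ennreal (exp (s * m y + s\<^sup>2 * real (card A) / 8)) \<partial>p x)"
  proof (rule nn_integral_mono)
    fix y
    show "(\<integral>\<^sup>+g. ennreal (exp (s * f (g(x := y)))) \<partial>?P)
        \<le> ennreal (exp (s * m y + s\<^sup>2 * real (card A) / 8))"
      unfolding m_def
    proof (rule insert.IH)
      fix g z v w assume "z \<in> A"
      then show "f (g(z := v, x := y)) \<le> f (g(z := w, x := y)) + 1"
        using insert.prems(2)[of z "g(x := y)" v w] insert.hyps(2)
        by (metis fun_upd_twist insertI2)
    qed (use insert.prems in auto)
  qed
  also have "\<dots> = ennreal (exp (s\<^sup>2 * real (card A) / 8)) * (\<integral>\<^sup>+y. ennreal (exp (s * m y)) \<partial>p x)"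
    by (subst nn_integral_cmult[symmetric]) (simp_all add: add.commute flip: ennreal_mult exp_add)
  also have "\<dots> \<le> ennreal (exp (s\<^sup>2 * real (card A) / 8)) *
      ennreal (exp (s * measure_pmf.expectation (p x) m + s\<^sup>2 * ((a + 1) - a)\<^sup>2 / 8))"
    by (intro mult_left_mono nn_integral_exp_le_Hoeffding mrange s) auto
  also have "\<dots> = ennreal (exp (s * measure_pmf.expectation (Pi_pmf (insert x A) d p) f
      + s\<^sup>2 * real (card (insert x A)) / 8))"
    using insert.hyps by (simp add: mexp algebra_simps add_divide_distrib flip: ennreal_mult exp_add)
  finally show ?case .
qed

text \<open>By convexity, \<open>exp\<close> lies below its chord between \<open>-1\<close> and
  \<open>0\<close>.\<close>

lemma one_minus_exp_ge_linear:
  fixes y :: real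
  assumes "0 \<le> y" "y \<le> 1"
  shows "(1 - exp (- 1)) * y \<le> 1 - exp (- y)"
proof -
  have "exp (1 * ((1 - y) *\<^sub>R 0 + y *\<^sub>R (-1))) \<le> (1 - y) * exp (1 * 0) + y * exp (1 * (-1::real))"
    using assms by (intro convex_onD[OF convex_on_exp]) auto
  then show ?thesis by (simp add: algebra_simps)
qed

text \<open>Since \<open>1 - x \<le> exp (- x)\<close>, the product is at most
  \<open>exp (- sum x I)\<close>; the chord bound then gives the ratio for loads up to 1. This is
  where \<open>1/e\<close> comes from.\<close>

lemma resolution_ratio_ge:
  fixes x :: "'i \<Rightarrow> real"
  assumes "finite I" "\<And>i. i \<in> I \<Longrightarrow> 0 \<le> x i \<and> x i \<le> 1" "0 < sum x I" "sum x I \<le> 1"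
  shows "1 - exp (- 1) \<le> (1 - (\<Prod>i\<in>I. 1 - x i)) / sum x I"
proof -
  have "(\<Prod>i\<in>I. 1 - x i) \<le> (\<Prod>i\<in>I. exp (- x i))"
    using assms(2) exp_ge_add_one_self[of "- x _"] by (intro prod_mono) (auto)
  also have "\<dots> = exp (- sum x I)"
    using assms(1) by (simp add: exp_sum sum_negf[symmetric])
  finally have "(1 - exp (- 1)) * sum x I \<le> 1 - (\<Prod>i\<in>I. 1 - x i)"
    using one_minus_exp_ge_linear[of "sum x I"] assms(3,4) by simp
  then show ?thesis using assms(3) by (simp add: field_simps)
qed

lemma map_pmf_of_set_eq_bernoulli:
  assumes "finite P" "P \<noteq> {}"
  shows "map_pmf (\<lambda>c. c = k) (pmf_of_set P) = bernoulli_pmf (of_bool (k \<in> P) / real (card P))"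
proof (rule pmf_eqI)
  fix b :: bool
  have p: "0 \<le> of_bool (k \<in> P) / real (card P)" "of_bool (k \<in> P) / real (card P) \<le> 1"
    using assms card_gt_0_iff[of P] by (auto simp: divide_simps)
  have t: "pmf (map_pmf (\<lambda>c. c = k) (pmf_of_set P)) True = of_bool (k \<in> P) / real (card P)"
    using assms by (auto simp: pmf_map vimage_def measure_pmf_of_set)
  have f: "pmf (map_pmf (\<lambda>c. c = k) (pmf_of_set P)) False
      = 1 - pmf (map_pmf (\<lambda>c. c = k) (pmf_of_set P)) True"
    by (rule pmf_False_conv_True)
  show "pmf (map_pmf (\<lambda>c. c = k) (pmf_of_set P)) b
      = pmf (bernoulli_pmf (of_bool (k \<in> P) / real (card P))) b"
    using p t f by (cases b) (simp_all only: pmf_bernoulli_True pmf_bernoulli_False)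
qed

section \<open>Reachable histories\<close>

text \<open>The law of a single record, kept apart from the history it extends: conditional
  probabilities given \<open>h\<close> become probabilities under
  \<open>arrival_pmf\<close>.\<close>

definition arrival_pmf ::
    "('u set \<Rightarrow> ('u \<Rightarrow> real) \<Rightarrow> 'u set \<Rightarrow> 'u set pmf) \<Rightarrow> nat set \<Rightarrow> ('u history \<Rightarrow> 'u set) \<Rightarrow>
      'u history \<Rightarrow> 'u arrival pmf" where
  "arrival_pmf crs C adv h =
     bind_pmf (Pi_pmf (adv h) 0 (\<lambda>u. pmf_of_set (palette C h u)))
       (\<lambda>c. map_pmf (\<lambda>S. (adv h, c, S))
         (Pi_pmf C {} (\<lambda>k. crs (adv h) (marginal C h k) {u \<in> adv h. c u = k})))"

lemma process_arrival_eq: "process_arrival crs C adv h = map_pmf (\<lambda>r. r # h) (arrival_pmf crs C adv h)"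
  by (simp add: process_arrival_def arrival_pmf_def map_bind_pmf pmf.map_comp o_def
      Let_def flip: map_pmf_def)

lemma map_choices_arrival_pmf:
  "map_pmf (\<lambda>(N, c, S). c) (arrival_pmf crs C adv h)
     = Pi_pmf (adv h) 0 (\<lambda>u. pmf_of_set (palette C h u))"
  by (simp add: arrival_pmf_def map_bind_pmf pmf.map_comp o_def bind_return_pmf' map_pmf_const)

lemma fst_arrival_pmf: "r \<in> set_pmf (arrival_pmf crs C adv h) \<Longrightarrow> fst r = adv h"
  by (auto simp: arrival_pmf_def)

lemma run_arrivals_Suc:
  "run_arrivals crs C adv (Suc t)
     = bind_pmf (run_arrivals crs C adv t) (\<lambda>h. map_pmf (\<lambda>r. r # h) (arrival_pmf crs C adv h))"
  by (simp add: process_arrival_eq[abs_def])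

lemma length_run_arrivals: "h \<in> set_pmf (run_arrivals crs C adv t) \<Longrightarrow> length h = t"
  by (induction t arbitrary: h) (auto simp: process_arrival_eq)

text \<open>The degree bound is assumed for complete runs only. It reaches shorter histories because
  each of them extends to a complete run and edges are never removed.\<close>

lemma run_arrivals_extend:
  assumes "h \<in> set_pmf (run_arrivals crs C adv t)" "t \<le> n"
  shows "\<exists>xs. xs @ h \<in> set_pmf (run_arrivals crs C adv n)"
  using assms(2)
proof (induction n rule: dec_induct)
  case base
  then show ?case using assms(1) by (intro exI[of _ "[]"]) simp
next
  case (step m)
  then obtain xs where xs: "xs @ h \<in> set_pmf (run_arrivals crs C adv m)" by blast
  obtain r where "r \<in> set_pmf (arrival_pmf crs C adv (xs @ h))"
    using set_pmf_not_empty[of "arrival_pmf crs C adv (xs @ h)"] by blast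
  with xs show ?case
    by (intro exI[of _ "r # xs"]) (auto simp: process_arrival_eq)
qed

lemma graph_edges_append: "graph_edges h \<subseteq> graph_edges (xs @ h)"
proof (induction xs)
  case (Cons r xs)
  then show ?case by (cases r) auto
qed simp

lemma graph_edges_time: "(u, t) \<in> graph_edges h \<Longrightarrow> t \<in> {1..length h}"
proof (induction h)
  case (Cons r h)
  then show ?case by (cases r) auto
qed simp

lemma color_assignment_time: "((u, t), k) \<in> color_assignment h \<Longrightarrow> t \<in> {1..length h}"
proof (induction h)
  case (Cons r h)
  then show ?case by (cases r) auto
qed simp

section \<open>Degrees and palettes along a history\<close>

definition degree :: "'u history \<Rightarrow> 'u \<Rightarrow> nat" where
  "degree h u = card {t. (u, t) \<in> graph_edges h}"

definition uncolored_degree :: "'u history \<Rightarrow> 'u \<Rightarrow> nat" where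
  "uncolored_degree h u = card {t. (u, t) \<in> graph_edges h - colored_edges h}"

lemma finite_times: "finite {t. (u, t) \<in> graph_edges h}"
  by (rule finite_subset[of _ "{1..length h}"]) (auto dest: graph_edges_time)

lemma degree_Nil [simp]: "degree [] u = 0"
  by (simp add: degree_def)

lemma degree_Cons: "degree ((N, c, S) # h) u = degree h u + of_bool (u \<in> N)"
proof -
  have "{t. (u, t) \<in> graph_edges ((N, c, S) # h)}
      = (if u \<in> N then insert (Suc (length h)) {t. (u, t) \<in> graph_edges h} else {t. (u, t) \<in> graph_edges h})"
    by auto
  moreover have "Suc (length h) \<notin> {t. (u, t) \<in> graph_edges h}"
    by (auto dest: graph_edges_time)
  ultimately show ?thesis by (simp add: degree_def finite_times)
qed

lemma uncolored_Cons:
  "graph_edges ((N, c, S) # h) - colored_edges ((N, c, S) # h)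
     = (graph_edges h - colored_edges h) \<union> (N - (\<Union>k. S k)) \<times> {Suc (length h)}"
proof -
  have "colored_edges ((N, c, S) # h) = colored_edges h \<union> (\<Union>k. S k) \<times> {Suc (length h)}"
    by (auto simp: colored_edges_def Domain_iff)
  moreover have "(u, Suc (length h)) \<notin> graph_edges h" "(u, Suc (length h)) \<notin> colored_edges h" for u
    by (auto simp: colored_edges_def dest!: graph_edges_time color_assignment_time)
  ultimately show ?thesis by auto
qed

lemma uncolored_degree_Nil [simp]: "uncolored_degree [] u = 0"
  by (simp add: uncolored_degree_def)

lemma uncolored_degree_Cons:
  "uncolored_degree ((N, c, S) # h) u = uncolored_degree h u + of_bool (u \<in> N - (\<Union>k. S k))"
proof -
  let ?T = "{t. (u, t) \<in> graph_edges h - colored_edges h}"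
  have "{t. (u, t) \<in> graph_edges ((N, c, S) # h) - colored_edges ((N, c, S) # h)}
      = (if u \<in> N - (\<Union>k. S k) then insert (Suc (length h)) ?T else ?T)"
    unfolding uncolored_Cons by auto
  moreover have "Suc (length h) \<notin> ?T"
    by (auto dest: graph_edges_time)
  moreover have "finite ?T"
    by (rule finite_subset[OF _ finite_times[of u h]]) auto
  ultimately show ?thesis by (simp add: uncolored_degree_def)
qed

lemma uncolored_at_last:
  "{u. (u, Suc (length h)) \<in> graph_edges ((N, c, S) # h) - colored_edges ((N, c, S) # h)}
     = N - (\<Union>k. S k)"
  unfolding uncolored_Cons by (auto dest: graph_edges_time)

lemma uncolored_at_earlier:
  "t \<le> length h \<Longrightarrow>
     {u. (u, t) \<in> graph_edges ((N, c, S) # h) - colored_edges ((N, c, S) # h)}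
       = {u. (u, t) \<in> graph_edges h - colored_edges h}"
  unfolding uncolored_Cons by auto

lemma palette_subset: "palette C h u \<subseteq> C"
proof (induction h)
  case (Cons r h)
  then show ?case by (cases r) auto
qed simp

text \<open>Each arrival adjacent to \<open>u\<close> raises its degree by one and removes at most
  one color.\<close>

lemma card_palette_ge:
  assumes "finite C"
  shows "card C \<le> card (palette C h u) + degree h u"
proof (induction h)
  case (Cons r h)
  then show ?case
    by (cases r) (auto simp: degree_Cons card_Diff_singleton_if)
qed simp

lemma max_degree_le_iff:
  assumes "finite U"
  shows "max_degree U n E \<le> d \<longleftrightarrow>
     (\<forall>u\<in>U. card {t. (u, t) \<in> E} \<le> d) \<and> (\<forall>t\<in>{1..n}. card {u. (u, t) \<in> E} \<le> d)"
  unfolding max_degree_def using assms by (subst Max_le_iff) auto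

lemma real_max_degree_le_iff:
  assumes "finite U" "0 \<le> x"
  shows "real (max_degree U n E) \<le> x \<longleftrightarrow>
     (\<forall>u\<in>U. real (card {t. (u, t) \<in> E}) \<le> x) \<and> (\<forall>t\<in>{1..n}. real (card {u. (u, t) \<in> E}) \<le> x)"
proof -
  have "real m \<le> x \<longleftrightarrow> m \<le> nat \<lfloor>x\<rfloor>" for m
    using assms(2) by linarith
  then show ?thesis by (simp add: max_degree_le_iff[OF assms(1)])
qed

text \<open>The picks are independent and \<open>u\<close> picks \<open>k\<close> with its marginal
  probability, so the set competing for \<open>k\<close> has the law that a contention resolution
  scheme expects. The default color \<open>0\<close> outside \<open>N\<close> must translate to
  \<open>False\<close>, hence \<open>k \<noteq> 0\<close>.\<close>

lemma product_set_pmf_marginal: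
  assumes "finite N" "\<And>u. u \<in> N \<Longrightarrow> finite (palette C h u) \<and> palette C h u \<noteq> {}" "k \<noteq> 0"
  shows "map_pmf (\<lambda>c. {u \<in> N. c u = k}) (Pi_pmf N 0 (\<lambda>u. pmf_of_set (palette C h u)))
     = product_set_pmf N (marginal C h k)"
proof -
  have "Pi_pmf N False (\<lambda>u. bernoulli_pmf (marginal C h k u))
      = Pi_pmf N False (\<lambda>u. map_pmf (\<lambda>c. c = k) (pmf_of_set (palette C h u)))"
    using assms(2) by (intro Pi_pmf_cong) (simp_all add: marginal_def map_pmf_of_set_eq_bernoulli)
  also have "\<dots> = map_pmf (\<lambda>c. (\<lambda>i. i = k) \<circ> c) (Pi_pmf N 0 (\<lambda>u. pmf_of_set (palette C h u)))"
    using assms(1,3) by (intro Pi_pmf_map) auto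
  finally show ?thesis
    by (simp add: product_set_pmf_def pmf.map_comp o_def)
qed

lemma contention_resolution_schemeD:
  assumes "contention_resolution_scheme crs" "finite I" "\<And>i. i \<in> I \<Longrightarrow> 0 \<le> x i \<and> x i \<le> 1"
  shows "R \<in> set_pmf (product_set_pmf I x) \<Longrightarrow> S \<in> set_pmf (crs I x R) \<Longrightarrow> S \<subseteq> R"
    and "R \<in> set_pmf (product_set_pmf I x) \<Longrightarrow> S \<in> set_pmf (crs I x R) \<Longrightarrow> R \<noteq> {} \<Longrightarrow> card S = 1"
    and "i \<in> I \<Longrightarrow> x i * ((1 - (\<Prod>j\<in>I. 1 - x j)) / (\<Sum>j\<in>I. x j))
           \<le> measure_pmf.prob (bind_pmf (product_set_pmf I x) (crs I x)) {S. i \<in> S}"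
proof -
  have *: "(\<forall>R \<in> set_pmf (product_set_pmf I x). \<forall>S \<in> set_pmf (crs I x R).
            S \<subseteq> R \<and> (R \<noteq> {} \<longrightarrow> card S = 1)) \<and>
        (\<forall>i\<in>I. measure_pmf.prob (bind_pmf (product_set_pmf I x) (crs I x)) {S. i \<in> S}
            \<ge> x i * ((1 - (\<Prod>j\<in>I. 1 - x j)) / (\<Sum>j\<in>I. x j)))"
    by (rule assms(1)[unfolded contention_resolution_scheme_def, THEN spec, THEN spec, THEN mp, THEN mp])
      (use assms(2,3) in auto)
  show "R \<in> set_pmf (product_set_pmf I x) \<Longrightarrow> S \<in> set_pmf (crs I x R) \<Longrightarrow> S \<subseteq> R"
    "R \<in> set_pmf (product_set_pmf I x) \<Longrightarrow> S \<in> set_pmf (crs I x R) \<Longrightarrow> R \<noteq> {} \<Longrightarrow> card S = 1"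
    "i \<in> I \<Longrightarrow> x i * ((1 - (\<Prod>j\<in>I. 1 - x j)) / (\<Sum>j\<in>I. x j))
           \<le> measure_pmf.prob (bind_pmf (product_set_pmf I x) (crs I x)) {S. i \<in> S}"
    using * by simp_all
qed

section \<open>The algorithm against an adversary that respects the degree bound\<close>

locale online_coloring =
  fixes crs :: "'u set \<Rightarrow> ('u \<Rightarrow> real) \<Rightarrow> 'u set \<Rightarrow> 'u set pmf"
    and C :: "nat set" and adv :: "'u history \<Rightarrow> 'u set"
    and U :: "'u set" and n :: nat and \<Delta> :: real
  assumes finite_U: "finite U" and finite_C: "finite C" and zero_notin_C: "0 \<notin> C"
    and crs: "contention_resolution_scheme crs"
    and Delta_le_C: "\<Delta> \<le> real (card C)"
    and bounded: "\<And>h. h \<in> set_pmf (run_arrivals crs C adv n) \<Longrightarrow>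
           graph_edges h \<subseteq> U \<times> {1..n} \<and> real (max_degree U n (graph_edges h)) \<le> \<Delta>"
begin

abbreviation run :: "nat \<Rightarrow> 'u history pmf" where
  "run \<equiv> run_arrivals crs C adv"

abbreviation arrival :: "'u history \<Rightarrow> 'u arrival pmf" where
  "arrival \<equiv> arrival_pmf crs C adv"

lemma Delta_nonneg: "0 \<le> \<Delta>"
proof -
  obtain h where "h \<in> set_pmf (run n)" using set_pmf_not_empty[of "run n"] by blast
  from bounded[OF this] show ?thesis by linarith
qed

lemma run_edges:
  assumes "h \<in> set_pmf (run t)" "t \<le> n"
  shows "graph_edges h \<subseteq> U \<times> {1..n}"
    and "u \<in> U \<Longrightarrow> real (degree h u) \<le> \<Delta>"
    and "j \<in> {1..n} \<Longrightarrow> real (card {u. (u, j) \<in> graph_edges h}) \<le> \<Delta>"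
proof -
  obtain xs where xs: "xs @ h \<in> set_pmf (run n)"
    using run_arrivals_extend[OF assms] by blast
  note b = bounded[OF xs]
  then have E: "graph_edges (xs @ h) \<subseteq> U \<times> {1..n}"
    and deg: "\<forall>u\<in>U. real (card {t. (u, t) \<in> graph_edges (xs @ h)}) \<le> \<Delta>"
      "\<forall>t\<in>{1..n}. real (card {u. (u, t) \<in> graph_edges (xs @ h)}) \<le> \<Delta>"
    by (simp_all add: real_max_degree_le_iff[OF finite_U Delta_nonneg])
  show "graph_edges h \<subseteq> U \<times> {1..n}"
    using E graph_edges_append[of h xs] by blast
  have "degree h u \<le> card {t. (u, t) \<in> graph_edges (xs @ h)}" for u
    unfolding degree_def using graph_edges_append[of h xs]
    by (intro card_mono finite_times) auto
  then show "real (degree h u) \<le> \<Delta>" if "u \<in> U"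
    using deg(1) that by (meson of_nat_mono order_trans)
  have "card {u. (u, j) \<in> graph_edges h} \<le> card {u. (u, j) \<in> graph_edges (xs @ h)}"
    using graph_edges_append[of h xs] E
    by (intro card_mono finite_subset[OF _ finite_U]) auto
  then show "real (card {u. (u, j) \<in> graph_edges h}) \<le> \<Delta>" if "j \<in> {1..n}"
    using deg(2) that by (meson of_nat_mono order_trans)
qed

text \<open>The chosen neighborhood is not yet part of \<open>h\<close>. Appending some possible
  record gives a reachable history whose degrees include the new edges, hence the
  \<open>+ 1\<close>.\<close>

lemma run_adv:
  assumes "h \<in> set_pmf (run t)" "t < n"
  shows "adv h \<subseteq> U" and "real (card (adv h)) \<le> \<Delta>"
    and "u \<in> adv h \<Longrightarrow> real (degree h u) + 1 \<le> \<Delta>"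
proof -
  obtain r where r: "r \<in> set_pmf (arrival h)" using set_pmf_not_empty[of "arrival h"] by blast
  then obtain c S where rr: "r = (adv h, c, S)"
    using fst_arrival_pmf[OF r] by (cases r) auto
  have "r # h \<in> set_pmf (run (Suc t))"
    using assms(1) r by (auto simp: process_arrival_eq)
  moreover have "Suc t \<le> n" using assms(2) by simp
  ultimately have E: "graph_edges (r # h) \<subseteq> U \<times> {1..n}"
    and deg: "\<And>u. u \<in> U \<Longrightarrow> real (degree (r # h) u) \<le> \<Delta>"
      "\<And>j. j \<in> {1..n} \<Longrightarrow> real (card {u. (u, j) \<in> graph_edges (r # h)}) \<le> \<Delta>"
    using run_edges by blast+
  show sub: "adv h \<subseteq> U"
    using E by (auto simp: rr)
  show "real (degree h u) + 1 \<le> \<Delta>" if "u \<in> adv h"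
    using deg(1)[of u] that sub by (auto simp: rr degree_Cons)
  have "{u. (u, Suc (length h)) \<in> graph_edges (r # h)} = adv h"
    by (auto simp: rr dest: graph_edges_time)
  then show "real (card (adv h)) \<le> \<Delta>"
    using deg(2)[of "Suc (length h)"] assms length_run_arrivals[OF assms(1)] by auto
qed

lemma finite_adv: "h \<in> set_pmf (run t) \<Longrightarrow> t < n \<Longrightarrow> finite (adv h)"
  by (rule finite_subset[OF run_adv(1) finite_U])

lemma finite_palette: "finite (palette C h u)"
  by (rule finite_subset[OF palette_subset finite_C])

lemma card_palette:
  assumes "h \<in> set_pmf (run t)" "t \<le> n" "u \<in> U"
  shows "real (card C) - \<Delta> \<le> real (card (palette C h u))"
  using card_palette_ge[OF finite_C, of h u] run_edges(2)[OF assms] by linarith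

text \<open>One edge at \<open>u\<close> is still to come, so one color more than in
  \<open>card_palette\<close> is left. The palette is therefore nonempty even if
  \<open>real (card C) = \<Delta>\<close>.\<close>

lemma card_palette_adv:
  assumes "h \<in> set_pmf (run t)" "t < n" "u \<in> adv h"
  shows "real (card C) - \<Delta> + 1 \<le> real (card (palette C h u))"
  using card_palette_ge[OF finite_C, of h u] run_adv(3)[OF assms] by linarith

lemma palette_nonempty:
  assumes "h \<in> set_pmf (run t)" "t < n" "u \<in> adv h"
  shows "palette C h u \<noteq> {}"
  using card_palette_adv[OF assms] Delta_le_C by auto

lemma marginal_range: "0 \<le> marginal C h k u \<and> marginal C h k u \<le> 1"
proof (cases "k \<in> palette C h u")
  case True
  then have "0 < card (palette C h u)" using finite_palette[of h u] by (auto simp: card_gt_0_iff)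
  then show ?thesis using True by (simp add: marginal_def)
qed (simp add: marginal_def)

lemma product_set_pmf_choices:
  assumes "h \<in> set_pmf (run t)" "t < n" "k \<in> C"
  shows "map_pmf (\<lambda>c. {u \<in> adv h. c u = k}) (Pi_pmf (adv h) 0 (\<lambda>u. pmf_of_set (palette C h u)))
     = product_set_pmf (adv h) (marginal C h k)"
proof (rule product_set_pmf_marginal)
  show "k \<noteq> 0" using assms(3) zero_notin_C by metis
qed (use assms finite_palette palette_nonempty finite_adv in auto)

lemma set_arrival:
  assumes h: "h \<in> set_pmf (run t)" "t < n" and r: "(N, c, S) \<in> set_pmf (arrival h)"
  shows "N = adv h" and "u \<in> N \<Longrightarrow> c u \<in> palette C h u" and "S k \<subseteq> {u \<in> N. c u = k}"
    and "u \<in> N \<Longrightarrow> card (S (c u)) = 1" and "k \<notin> C \<Longrightarrow> S k = {}"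
proof -
  show N: "N = adv h" using fst_arrival_pmf[OF r] by simp
  have c: "c \<in> set_pmf (Pi_pmf (adv h) 0 (\<lambda>u. pmf_of_set (palette C h u)))"
    and S: "S \<in> set_pmf (Pi_pmf C {} (\<lambda>k. crs (adv h) (marginal C h k) {u \<in> adv h. c u = k}))"
    using r by (auto simp: arrival_pmf_def)
  show cu: "c u \<in> palette C h u" if "u \<in> N" for u
  proof -
    have "c u \<in> set_pmf (pmf_of_set (palette C h u))"
      using c that by (auto simp: set_Pi_pmf[OF finite_adv[OF h]] PiE_dflt_def N)
    then show ?thesis
      using palette_nonempty[OF h, of u] finite_palette[of h u] that N by simp
  qed
  show S0: "S k = {}" if "k \<notin> C" for k
    using S that by (auto simp: set_Pi_pmf[OF finite_C] PiE_dflt_def)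
  have Sk: "S k \<in> set_pmf (crs (adv h) (marginal C h k) {u \<in> adv h. c u = k})" if "k \<in> C" for k
    using S that by (auto simp: set_Pi_pmf[OF finite_C] PiE_dflt_def)
  \<comment> \<open>The scheme is constrained only on sets in the support of the product
    distribution, so the realized set must first be placed there.\<close>
  have R: "{u \<in> adv h. c u = k} \<in> set_pmf (product_set_pmf (adv h) (marginal C h k))" if "k \<in> C" for k
    unfolding product_set_pmf_choices[OF h that, symmetric] using c by auto
  show "S k \<subseteq> {u \<in> N. c u = k}"
  proof (cases "k \<in> C")
    case True
    show ?thesis unfolding N
      by (rule contention_resolution_schemeD(1)[OF crs finite_adv[OF h] marginal_range R[OF True] Sk[OF True]])
  qed (simp add: S0)
  show "card (S (c u)) = 1" if "u \<in> N"
  proof -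
    have k: "c u \<in> C" using cu[OF that] palette_subset[of C h u] by (rule subsetD[rotated])
    show ?thesis
      by (rule contention_resolution_schemeD(2)[OF crs finite_adv[OF h] marginal_range R[OF k] Sk[OF k]])
        (use that N in auto)
  qed
qed

text \<open>Every picked color goes to exactly one of the edges that picked it. The number of
  colored edges is thus determined by the picks \<open>c\<close> alone, whatever the scheme
  outputs.\<close>

lemma card_colored:
  assumes h: "h \<in> set_pmf (run t)" "t < n" and r: "(N, c, S) \<in> set_pmf (arrival h)"
  shows "card (\<Union>k. S k) = card (c ` N)"
proof -
  note set = set_arrival[OF h r]
  have "inj_on c (\<Union>k. S k)"
  proof (rule inj_onI)
    fix u v assume "u \<in> (\<Union>k. S k)" "v \<in> (\<Union>k. S k)" "c u = c v"
    then obtain k l where "u \<in> S k" "v \<in> S l" "c u = c v" by auto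
    then have "u \<in> S (c u)" "v \<in> S (c u)" "u \<in> N" using set(3)[of k] set(3)[of l] by auto
    then show "u = v" using set(4)[of u] by (auto simp: card_1_singleton_iff)
  qed
  moreover have "c ` (\<Union>k. S k) = c ` N"
  proof (intro subset_antisym subsetI)
    fix k assume "k \<in> c ` N"
    then obtain u where "u \<in> N" "k = c u" by auto
    then obtain v where "v \<in> S k" using set(4)[of u] by (auto simp: card_1_singleton_iff)
    then show "k \<in> c ` (\<Union>k. S k)" using set(3)[of k] by auto
  next
    fix k assume "k \<in> c ` (\<Union>k. S k)"
    then obtain u l where "u \<in> S l" "k = c u" by auto
    then show "k \<in> c ` N" using set(3)[of l] by auto
  qed
  ultimately show ?thesis using card_image by fastforce
qed

text \<open>A colored edge carries the color it picked, and that color has left the palette of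
  \<open>u\<close> for good. This excludes clashes at offline nodes.\<close>

lemma color_assignment_notin_palette:
  assumes "h \<in> set_pmf (run t)" "t \<le> n" "((u, j), k) \<in> color_assignment h"
  shows "k \<notin> palette C h u"
  using assms
proof (induction t arbitrary: h)
  case (Suc t)
  then obtain h' N c S where h: "h = (N, c, S) # h'" "h' \<in> set_pmf (run t)" "(N, c, S) \<in> set_pmf (arrival h')"
    by (auto simp: process_arrival_eq)
  moreover have "t < n" using Suc.prems by simp
  ultimately have "S k \<subseteq> {u \<in> N. c u = k}" by (intro set_arrival)
  then show ?case using Suc.IH[OF h(2)] Suc.prems h(1) by (auto split: if_splits)
qed simp

text \<open>Palettes exclude clashes at an offline node; at an online node each color goes to a
  single edge. No edge gets two colors because \<open>u \<in> S k\<close> forces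
  \<open>k = c u\<close>.\<close>

lemma proper_coloring:
  assumes "h \<in> set_pmf (run t)" "t \<le> n"
  shows "proper_partial_edge_coloring (graph_edges h) C (color_assignment h)"
  using assms
proof (induction t arbitrary: h)
  case 0
  then show ?case by (simp add: proper_partial_edge_coloring_def)
next
  case (Suc t)
  then obtain h' N c S where h: "h = (N, c, S) # h'" "h' \<in> set_pmf (run t)" "(N, c, S) \<in> set_pmf (arrival h')"
    by (auto simp: process_arrival_eq)
  have t: "t < n" using Suc.prems by simp
  note set = set_arrival[OF h(2) t h(3)]
  let ?j = "Suc (length h')"
  have IH: "single_valued (color_assignment h')" "Domain (color_assignment h') \<subseteq> graph_edges h'"
    "Range (color_assignment h') \<subseteq> C"
    "\<And>u j k u' j'. ((u, j), k) \<in> color_assignment h' \<Longrightarrow> ((u', j'), k) \<in> color_assignment h' \<Longrightarrow>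
       u = u' \<or> j = j' \<Longrightarrow> (u, j) = (u', j')"
    using Suc.IH[OF h(2) less_imp_le[OF t]] unfolding proper_partial_edge_coloring_def by fastforce+
  have new: "u \<in> N \<and> k = c u \<and> k \<in> palette C h' u" if "u \<in> S k" for u k
    using set(2)[of u] set(3)[of k] that by auto
  have old: "j \<noteq> ?j" if "((u, j), k) \<in> color_assignment h'" for u j k
    using color_assignment_time[OF that] by auto
  have uniq: "u = v" if "u \<in> S k" "v \<in> S k" for u v k
    using new[OF that(1)] that set(4)[of u] by (auto simp: card_1_singleton_iff)
  have fresh: "((u, j), k) \<notin> color_assignment h'" if "u \<in> S k" for u j k
    using color_assignment_notin_palette[OF h(2)] new[OF that] t by auto
  have mem: "((u, j), k) \<in> color_assignment h \<longleftrightarrow>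
      ((u, j), k) \<in> color_assignment h' \<or> j = ?j \<and> u \<in> S k" for u j k
    by (auto simp: h(1))
  show ?case
    unfolding proper_partial_edge_coloring_def
  proof (intro conjI)
    show "single_valued (color_assignment h)"
    proof (rule single_valuedI)
      fix e k l assume "(e, k) \<in> color_assignment h" "(e, l) \<in> color_assignment h"
      then show "k = l"
        using IH(1) by (cases e) (auto simp: mem dest: old new single_valuedD)
    qed
    show "Domain (color_assignment h) \<subseteq> graph_edges h"
    proof
      fix e assume "e \<in> Domain (color_assignment h)"
      then obtain u j k where "e = (u, j)" "((u, j), k) \<in> color_assignment h"
        by (metis DomainE surj_pair)
      then show "e \<in> graph_edges h"
        using IH(2) by (auto simp: mem h(1) dest: new)
    qed
    show "Range (color_assignment h) \<subseteq> C"
    proof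
      fix k assume "k \<in> Range (color_assignment h)"
      then obtain u j where "((u, j), k) \<in> color_assignment h"
        by (metis RangeE surj_pair)
      then show "k \<in> C"
        using IH(3) palette_subset[of C h'] by (auto simp: mem dest!: new)
    qed
    show "\<forall>(e, k)\<in>color_assignment h. \<forall>(e', k')\<in>color_assignment h.
        e \<noteq> e' \<and> (fst e = fst e' \<or> snd e = snd e') \<longrightarrow> k \<noteq> k'"
    proof (clarsimp simp: mem)
      fix u j u' j' k
      assume a: "((u, j), k) \<in> color_assignment h' \<or> j = ?j \<and> u \<in> S k"
        "((u', j'), k) \<in> color_assignment h' \<or> j' = ?j \<and> u' \<in> S k"
        "u = u' \<longrightarrow> j \<noteq> j'" "u = u' \<or> j = j'"
      then show False
        using IH(4)[of u j k u' j'] fresh old uniq by blast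
    qed
  qed
qed

end

section \<open>Loads and the probability of staying uncolored\<close>

text \<open>Every such set is the image of a map from \<open>{..<D}\<close> to \<open>U\<close>:
  enumerate it and repeat the last element, which exists by nonemptiness.\<close>

lemma card_nonempty_subsets_le:
  assumes "finite U"
  shows "card {N. N \<subseteq> U \<and> N \<noteq> {} \<and> card N \<le> D} \<le> card U ^ D"
proof -
  let ?F = "{..<D} \<rightarrow>\<^sub>E U"
  have fin: "finite ?F" using assms by (intro finite_PiE) auto
  have "{N. N \<subseteq> U \<and> N \<noteq> {} \<and> card N \<le> D} \<subseteq> (\<lambda>f. f ` {..<D}) ` ?F"
  proof
    fix N assume "N \<in> {N. N \<subseteq> U \<and> N \<noteq> {} \<and> card N \<le> D}"
    then have N: "N \<subseteq> U" "N \<noteq> {}" "card N \<le> D" by auto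
    have "finite N" using N(1) assms finite_subset by metis
    then obtain g where g: "bij_betw g {0..<card N} N"
      using ex_bij_betw_nat_finite by metis
    have pos: "0 < card N" using \<open>finite N\<close> N(2) by (simp add: card_gt_0_iff)
    define f where "f = restrict (\<lambda>i. g (min i (card N - 1))) {..<D}"
    have "f i \<in> N" if "i < D" for i
    proof -
      have "min i (card N - 1) \<in> {0..<card N}" using pos by auto
      then show ?thesis using that g by (auto simp: f_def bij_betw_def)
    qed
    moreover have "N \<subseteq> f ` {..<D}"
    proof
      fix u assume "u \<in> N"
      then obtain i where i: "i < card N" "u = g i"
        using g unfolding bij_betw_def by (metis atLeastLessThan_iff imageE)
      then have "f i = u" "i < D" using N(3) by (auto simp: f_def)
      then show "u \<in> f ` {..<D}" by auto
    qed
    ultimately have "f ` {..<D} = N" by auto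
    moreover have "f \<in> ?F" using \<open>\<And>i. i < D \<Longrightarrow> f i \<in> N\<close> N(1) by (auto simp: f_def)
    ultimately show "N \<in> (\<lambda>f. f ` {..<D}) ` ?F" by (metis image_eqI)
  qed
  then have "card {N. N \<subseteq> U \<and> N \<noteq> {} \<and> card N \<le> D} \<le> card ?F"
    using fin by (meson card_image_le card_mono finite_imageI order_trans)
  then show ?thesis by (simp add: card_PiE)
qed

text \<open>When a palette shrinks from \<open>p\<close> to \<open>p - 1\<close> colors, the fraction of \<open>K\<close> in it ranges over an
  interval of length \<open>1 / (p - 1)\<close>; the resulting variance terms are dominated by the telescoping
  differences \<open>1 / (p - 2) - 1 / (p - 1)\<close>.\<close>

definition palette_potential :: "real \<Rightarrow> nat set \<Rightarrow> nat set \<Rightarrow> real" where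
  "palette_potential s K P
     = exp (s * (real (card (K \<inter> P)) / real (card P)) - s\<^sup>2 / (8 * (real (card P) - 1)))"

text \<open>Removing a uniform color preserves the mean of the fraction of \<open>K\<close>, so
  Hoeffding's lemma leaves only a variance term, which the decrease of the correction term absorbs.
  With at least 3 colors \<open>p - 2\<close> stays positive.\<close>

lemma palette_potential_supermartingale:
  assumes fin: "finite P" and P: "3 \<le> card P" and s: "0 < s"
  shows "(\<integral>\<^sup>+c. ennreal (palette_potential s K (P - {c})) \<partial>pmf_of_set P)
           \<le> ennreal (palette_potential s K P)"
proof -
  define p where "p = real (card P)"
  define a where "a = real (card (K \<inter> P))"
  define f where "f c = (a - of_bool (c \<in> K)) / (p - 1)" for c
  have p: "3 \<le> p" using P by (simp add: p_def)
  have ne: "P \<noteq> {}" using P by auto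
  have pot: "palette_potential s K (P - {c}) = exp (s * f c) * exp (- s\<^sup>2 / (8 * (p - 2)))"
    if "c \<in> P" for c
  proof -
    have "real (card (K \<inter> (P - {c}))) = a - of_bool (c \<in> K)"
    proof (cases "c \<in> K")
      case True
      have "K \<inter> (P - {c}) = (K \<inter> P) - {c}" by auto
      moreover have "c \<in> K \<inter> P" using True that by simp
      moreover from this have "0 < card (K \<inter> P)" using fin card_gt_0_iff by blast
      ultimately show ?thesis using True by (simp add: a_def of_nat_diff)
    next
      case False
      then have "K \<inter> (P - {c}) = K \<inter> P" by auto
      then show ?thesis using False by (simp add: a_def)
    qed
    moreover have "real (card (P - {c})) = p - 1"
      using that P by (simp add: p_def of_nat_diff)
    ultimately show ?thesis
      by (simp add: palette_potential_def f_def flip: exp_add)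
  qed
  have Ef: "measure_pmf.expectation (pmf_of_set P) f = a / p"
  proof -
    have "(\<Sum>c\<in>P. a - of_bool (c \<in> K)) = p * a - (\<Sum>c\<in>P. of_bool (c \<in> K))"
      by (simp add: sum_subtractf p_def)
    also have "(\<Sum>c\<in>P. of_bool (c \<in> K)) = a"
      using fin by (simp add: a_def of_bool_def sum.If_cases Int_commute)
    finally have "(\<Sum>c\<in>P. f c) = (p * a - a) / (p - 1)"
      by (simp add: f_def flip: sum_divide_distrib)
    also have "\<dots> = a"
      using p by (simp add: field_simps)
    finally show ?thesis
      using fin ne by (simp add: integral_pmf_of_set p_def)
  qed
  have "(\<integral>\<^sup>+c. ennreal (palette_potential s K (P - {c})) \<partial>pmf_of_set P)
      = (\<integral>\<^sup>+c. ennreal (exp (s * f c)) * ennreal (exp (- s\<^sup>2 / (8 * (p - 2)))) \<partial>pmf_of_set P)"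
    using fin ne by (intro nn_integral_cong_AE) (auto simp: AE_measure_pmf_iff pot ennreal_mult)
  also have "\<dots> = (\<integral>\<^sup>+c. ennreal (exp (s * f c)) \<partial>pmf_of_set P) * ennreal (exp (- s\<^sup>2 / (8 * (p - 2))))"
    by (rule nn_integral_multc) simp
  also have "\<dots> \<le> ennreal (exp (s * (a / p) + s\<^sup>2 * (a / (p - 1) - (a - 1) / (p - 1))\<^sup>2 / 8))
      * ennreal (exp (- s\<^sup>2 / (8 * (p - 2))))"
    unfolding Ef[symmetric] using p s
    by (intro mult_right_mono nn_integral_exp_le_Hoeffding) (auto simp: f_def divide_right_mono)
  also have "\<dots> = ennreal (exp (s * (a / p) + s\<^sup>2 / 8 * (1 / (p - 1)\<^sup>2 - 1 / (p - 2))))"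
    by (simp add: diff_divide_distrib[symmetric] power_divide right_diff_distrib
        flip: ennreal_mult exp_add)
  also have "\<dots> \<le> ennreal (palette_potential s K P)"
  proof -
    have "1 / (p - 1)\<^sup>2 \<le> 1 / ((p - 1) * (p - 2))"
      using p by (intro divide_left_mono) (auto simp: power2_eq_square)
    also have "\<dots> = 1 / (p - 2) - 1 / (p - 1)"
      using p by (simp add: field_simps)
    finally have "s\<^sup>2 / 8 * (1 / (p - 1)\<^sup>2 - 1 / (p - 2)) \<le> s\<^sup>2 / 8 * (- 1 / (p - 1))"
      by (intro mult_left_mono) auto
    then show ?thesis
      by (intro ennreal_leI) (simp add: palette_potential_def flip: a_def p_def)
  qed
  finally show ?thesis .
qed

context online_coloring
begin

definition load :: "'u history \<Rightarrow> nat \<Rightarrow> real" where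
  "load h k = (\<Sum>u\<in>adv h. marginal C h k u)"

definition overloaded_colors :: "'u history \<Rightarrow> nat set" where
  "overloaded_colors h = {k \<in> C. 1 < load h k}"

lemma finite_overloaded_colors: "finite (overloaded_colors h)"
  using finite_C by (simp add: overloaded_colors_def)

text \<open>All colors are resolved on the same picks, so the outputs are dependent; but the output
  for a single \<open>k\<close> has exactly the law that the guarantee of the scheme refers
  to.\<close>

lemma map_resolved_arrival:
  assumes "h \<in> set_pmf (run t)" "t < n" "k \<in> C"
  shows "map_pmf (\<lambda>(N, c, S). S k) (arrival h)
     = bind_pmf (product_set_pmf (adv h) (marginal C h k)) (crs (adv h) (marginal C h k))"
  unfolding product_set_pmf_choices[OF assms, symmetric]
  using assms(3) finite_C
  by (simp add: arrival_pmf_def map_bind_pmf pmf.map_comp o_def bind_map_pmf Pi_pmf_component)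

text \<open>A palette color that is not overloaded is assigned to the edge of \<open>u\<close> with
  probability at least \<open>(1 - 1/e) / p\<close>, where \<open>p\<close> is the palette size.
  These events are disjoint for distinct colors, so the probabilities add up.\<close>

lemma prob_uncolored_le:
  assumes h: "h \<in> set_pmf (run t)" "t < n" and u: "u \<in> adv h"
  shows "measure_pmf.prob (arrival h) {(N, c, S). u \<notin> (\<Union>k. S k)}
           \<le> exp (- 1) + real (card (overloaded_colors h)) / real (card (palette C h u))"
proof -
  let ?P = "palette C h u"
  \<comment> \<open>Only within the support does \<open>u \<in> S k\<close> imply that
    \<open>u\<close> picked \<open>k\<close>, which makes these events disjoint.\<close>
  define A where "A k = {(N, c, S). u \<in> (S :: nat \<Rightarrow> 'u set) k} \<inter> set_pmf (arrival h)" for k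
  define p where "p = real (card ?P)"
  define b where "b = 1 - exp (- 1 :: real)"
  have b: "0 \<le> b" "b \<le> 1" by (auto simp: b_def)
  have p: "0 < p"
    using palette_nonempty[OF h u] finite_palette[of h u] by (simp add: p_def card_gt_0_iff)
  have A: "of_bool (k \<in> ?P - overloaded_colors h) * (b / p) \<le> measure_pmf.prob (arrival h) (A k)"
    if "k \<in> C" for k
  proof (cases "k \<in> ?P - overloaded_colors h")
    case True
    have "load h k \<le> 1" using True that by (auto simp: overloaded_colors_def)
    have x: "marginal C h k u = 1 / p" using True by (simp add: marginal_def p_def)
    \<comment> \<open>The marginal of \<open>u\<close> itself makes the load positive, as the
      quotient in \<open>resolution_ratio_ge\<close> requires.\<close>
    have "1 / p \<le> load h k"
      unfolding load_def x[symmetric] using finite_adv[OF h] u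
      by (intro member_le_sum) (simp_all add: marginal_range)
    then have "0 < load h k" using p by (smt (verit) divide_pos_pos)
    then have "b \<le> (1 - (\<Prod>v\<in>adv h. 1 - marginal C h k v)) / (\<Sum>v\<in>adv h. marginal C h k v)"
      unfolding b_def using \<open>load h k \<le> 1\<close> finite_adv[OF h]
      by (intro resolution_ratio_ge) (simp_all add: load_def marginal_range)
    then have "marginal C h k u * b \<le> marginal C h k u *
        ((1 - (\<Prod>v\<in>adv h. 1 - marginal C h k v)) / (\<Sum>v\<in>adv h. marginal C h k v))"
      by (intro mult_left_mono) (simp_all add: marginal_range)
    also have "\<dots> \<le> measure_pmf.prob
        (bind_pmf (product_set_pmf (adv h) (marginal C h k)) (crs (adv h) (marginal C h k))) {S. u \<in> S}"
      by (intro contention_resolution_schemeD(3)[OF crs] finite_adv[OF h] marginal_range u)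
    also have "\<dots> = measure_pmf.prob (arrival h) (A k)"
      unfolding map_resolved_arrival[OF h that, symmetric] A_def measure_Int_set_pmf
      by (simp add: vimage_def case_prod_unfold)
    finally show ?thesis using True by (simp add: x)
  next
    case False
    then show ?thesis by (simp only: of_bool_eq mult_zero_left measure_nonneg)
  qed
  have "p - real (card (overloaded_colors h)) \<le> real (card (?P - overloaded_colors h))"
    using diff_card_le_card_Diff[OF finite_overloaded_colors, of ?P h] by (simp add: p_def)
  then have "(p - real (card (overloaded_colors h))) * (b / p) \<le> real (card (?P - overloaded_colors h)) * (b / p)"
    using p b by (intro mult_right_mono) auto
  also have "\<dots> = (\<Sum>k\<in>C. of_bool (k \<in> ?P - overloaded_colors h) * (b / p))"
  proof -
    have "C \<inter> {k. k \<in> ?P - overloaded_colors h} = ?P - overloaded_colors h" using palette_subset[of C h u] by auto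
    then show ?thesis
      unfolding sum_distrib_right[symmetric] of_bool_def
      using finite_C by (simp only: sum.If_cases sum_constant sum.neutral_const add_0_right mult_1_right mult_zero_right)
  qed
  also have "\<dots> \<le> (\<Sum>k\<in>C. measure_pmf.prob (arrival h) (A k))"
    by (intro sum_mono A)
  also have "\<dots> = measure_pmf.prob (arrival h) (\<Union>k\<in>C. A k)"
  proof (rule measure_pmf.finite_measure_finite_Union[symmetric])
    show "disjoint_family_on A C"
      unfolding disjoint_family_on_def
    proof (intro ballI impI)
      fix k l :: nat assume "k \<noteq> l"
      have A_color: "fst (snd r) u = k" if "r \<in> A k" for r k
        using that set_arrival(3)[OF h, of "fst r" "fst (snd r)" "snd (snd r)" k]
        by (auto simp: A_def)
      show "A k \<inter> A l = {}"
        using A_color \<open>k \<noteq> l\<close> by (metis disjoint_iff)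
    qed
  qed (use finite_C in auto)
  also have "\<dots> \<le> measure_pmf.prob (arrival h) (- {(N, c, S). u \<notin> (\<Union>k. S k)})"
    by (intro measure_pmf.finite_measure_mono) (auto simp: A_def)
  also have "\<dots> = 1 - measure_pmf.prob (arrival h) {(N, c, S). u \<notin> (\<Union>k. S k)}"
    using measure_pmf.prob_compl[of "{(N, c, S). u \<notin> (\<Union>k. S k)}" "arrival h"]
    by (simp add: Compl_eq_Diff_UNIV)
  finally have "measure_pmf.prob (arrival h) {(N, c, S). u \<notin> (\<Union>k. S k)}
      \<le> 1 - b + b * (real (card (overloaded_colors h)) / p)"
    using p by (simp add: field_simps)
  also have "b * (real (card (overloaded_colors h)) / p) \<le> 1 * (real (card (overloaded_colors h)) / p)"
    using b p by (intro mult_right_mono) auto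
  finally show ?thesis by (simp add: b_def p_def)
qed

text \<open>By \<open>card_colored\<close> the number of uncolored edges is \<open>card N\<close>
  minus the number of distinct picked colors. This is a function of independent picks that changes
  by at most 1 with each of them.\<close>

lemma prob_uncolored_online_le:
  assumes h: "h \<in> set_pmf (run t)" "t < n" and s: "0 < s"
    and \<mu>: "\<And>u. u \<in> adv h \<Longrightarrow> measure_pmf.prob (arrival h) {(N, c, S). u \<notin> (\<Union>k. S k)} \<le> \<mu>"
  shows "measure_pmf.prob (arrival h) {(N, c, S). x < real (card (N - (\<Union>k. S k)))}
           \<le> exp ((s * \<mu> + s\<^sup>2 / 8) * real (card (adv h)) - s * x)"
proof -
  let ?N = "adv h"
  let ?Pi = "Pi_pmf ?N 0 (\<lambda>u. pmf_of_set (palette C h u))"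
  define f where "f c = real (card ?N) - real (card ((c :: 'u \<Rightarrow> nat) ` ?N))" for c
  have fin: "finite ?N" by (rule finite_adv[OF h])
  have f: "f c = real (card (N - (\<Union>k. S k)))" "N = ?N" if "(N, c, S) \<in> set_pmf (arrival h)" for N c S
  proof -
    note set = set_arrival[OF h that]
    have "(\<Union>k. S k) \<subseteq> N" using set(3) by auto
    moreover from this have "finite (\<Union>k. S k)" using fin set(1) finite_subset by metis
    moreover have "card (\<Union>k. S k) \<le> card N"
      using \<open>(\<Union>k. S k) \<subseteq> N\<close> fin set(1) by (auto intro: card_mono)
    ultimately show "f c = real (card (N - (\<Union>k. S k)))"
      using card_colored[OF h that] set(1) by (simp add: f_def card_Diff_subset of_nat_diff)
    show "N = ?N" by (rule set(1))
  qed
  \<comment> \<open>As \<open>f\<close> depends on the picks only, its mean may be taken over the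
    whole arrival, where it is the sum of the probabilities of staying uncolored.\<close>
  have "measure_pmf.expectation ?Pi f = measure_pmf.expectation (arrival h) (\<lambda>(N, c, S). f c)"
    unfolding map_choices_arrival_pmf[of crs C adv h, symmetric] by (simp add: case_prod_unfold)
  also have "\<dots> = measure_pmf.expectation (arrival h)
      (\<lambda>r. \<Sum>u\<in>?N. indicator {(N, c, S). u \<notin> (\<Union>k. S k)} r)"
  proof (intro integral_cong_AE AE_pmfI)
    fix r assume r: "r \<in> set_pmf (arrival h)"
    obtain N c S where rr: "r = (N, c, S)" by (cases r)
    show "(case r of (N, c, S) \<Rightarrow> f c) = (\<Sum>u\<in>?N. indicator {(N, c, S). u \<notin> (\<Union>k. S k)} r)"
      using f[OF r[unfolded rr]] fin
      by (simp add: rr indicator_def sum.If_cases Diff_eq Compl_eq)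
  qed auto
  also have "\<dots> = (\<Sum>u\<in>?N. measure_pmf.prob (arrival h) {(N, c, S). u \<notin> (\<Union>k. S k)})"
    by (subst Bochner_Integration.integral_sum)
      (auto simp: measure_pmf.emeasure_eq_measure intro!: measure_pmf.integrable_const_bound[where B = 1])
  also have "\<dots> \<le> real (card ?N) * \<mu>"
    using sum_bounded_above[of ?N _ \<mu>] \<mu> by simp
  finally have Ef: "s * measure_pmf.expectation ?Pi f \<le> s * (real (card ?N) * \<mu>)"
    using s by (intro mult_left_mono) auto
  have "(\<integral>\<^sup>+r. ennreal (exp (s * (case r of (N, c, S) \<Rightarrow> f c))) \<partial>arrival h)
      = (\<integral>\<^sup>+c. ennreal (exp (s * f c)) \<partial>?Pi)"
    unfolding map_choices_arrival_pmf[of crs C adv h, symmetric] by (simp add: case_prod_unfold)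
  also have "\<dots> \<le> ennreal (exp (s * measure_pmf.expectation ?Pi f + s\<^sup>2 * real (card ?N) / 8))"
  proof (rule nn_integral_exp_le_bounded_differences[OF fin _ _ s])
    show "finite (set_pmf (pmf_of_set (palette C h u)))" if "u \<in> ?N" for u
      using palette_nonempty[OF h that] finite_palette[of h u] by simp
    fix g :: "'u \<Rightarrow> nat" and u y z assume u: "u \<in> ?N"
    have upd: "(g(u := v)) ` ?N = insert v (g ` (?N - {u}))" for v
      using u by auto
    have "card ((g(u := z)) ` ?N) \<le> card (g ` (?N - {u})) + 1"
      "card (g ` (?N - {u})) \<le> card ((g(u := y)) ` ?N)"
      unfolding upd using fin by (auto simp: card_insert_if)
    then show "f (g(u := y)) \<le> f (g(u := z)) + 1"
      unfolding f_def by linarith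
  qed
  also have "\<dots> \<le> ennreal (exp ((s * \<mu> + s\<^sup>2 / 8) * real (card ?N)))"
    using Ef by (intro ennreal_leI) (simp add: algebra_simps)
  finally have "(\<integral>\<^sup>+r. ennreal (exp (s * (case r of (N, c, S) \<Rightarrow> f c))) \<partial>arrival h)
      \<le> ennreal (exp ((s * \<mu> + s\<^sup>2 / 8) * real (card ?N)))" .
  then show ?thesis
    by (rule prob_le_exp_Markov[rotated]) (use f s in auto)
qed

section \<open>Few colors are overloaded\<close>

text \<open>A nonnegative supermartingale has mean at most its initial value. Adaptivity is harmless
  here, since the next neighborhood is fixed once \<open>h\<close> is given.\<close>

lemma nn_integral_run_le_initial:
  assumes "\<And>i h. i < n \<Longrightarrow> h \<in> set_pmf (run i) \<Longrightarrow> (\<integral>\<^sup>+r. F (r # h) \<partial>arrival h) \<le> F h" "t \<le> n"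
  shows "(\<integral>\<^sup>+h. F h \<partial>run t) \<le> F []"
  using assms(2)
proof (induction t)
  case (Suc t)
  have "(\<integral>\<^sup>+h. F h \<partial>run (Suc t)) = (\<integral>\<^sup>+h. \<integral>\<^sup>+r. F (r # h) \<partial>arrival h \<partial>run t)"
    unfolding run_arrivals_Suc by simp
  also have "\<dots> \<le> (\<integral>\<^sup>+h. F h \<partial>run t)"
    using assms(1)[of t] Suc.prems by (intro nn_integral_mono_AE) (simp add: AE_measure_pmf_iff)
  also have "\<dots> \<le> F []" using Suc by simp
  finally show ?case .
qed simp

lemma prob_run_Suc_le:
  assumes "\<And>h. h \<in> set_pmf (run t) \<Longrightarrow> h \<notin> B \<Longrightarrow> measure_pmf.prob (arrival h) {r. r # h \<in> A} \<le> \<delta>" "0 \<le> \<delta>"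
  shows "measure_pmf.prob (run (Suc t)) A \<le> measure_pmf.prob (run t) B + \<delta>"
proof -
  have "emeasure (run (Suc t)) A = (\<integral>\<^sup>+h. emeasure (arrival h) {r. r # h \<in> A} \<partial>run t)"
    unfolding run_arrivals_Suc by (simp add: vimage_def)
  also have "\<dots> \<le> (\<integral>\<^sup>+h. indicator B h + ennreal \<delta> \<partial>run t)"
  proof (intro nn_integral_mono_AE AE_pmfI)
    fix h assume h: "h \<in> set_pmf (run t)"
    show "emeasure (arrival h) {r. r # h \<in> A} \<le> indicator B h + ennreal \<delta>"
    proof (cases "h \<in> B")
      case True
      then show ?thesis
        using measure_pmf.emeasure_le_1[of "arrival h" "{r. r # h \<in> A}"] by (simp add: add_increasing2)
    next
      case False
      then show ?thesis
        using assms(1)[OF h] by (simp add: measure_pmf.emeasure_eq_measure ennreal_leI)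
    qed
  qed
  also have "\<dots> = ennreal (measure_pmf.prob (run t) B + \<delta>)"
    using assms(2) by (simp add: nn_integral_add measure_pmf.emeasure_eq_measure)
  finally have "ennreal (measure_pmf.prob (run (Suc t)) A) \<le> ennreal (measure_pmf.prob (run t) B + \<delta>)"
    unfolding measure_pmf.emeasure_eq_measure .
  then show ?thesis
    using assms(2) by (subst (asm) ennreal_le_iff) (simp_all add: add_nonneg_nonneg)
qed

text \<open>The set \<open>N\<close> is fixed in advance and unrelated to \<open>adv h\<close>.
  Given \<open>h\<close>, the nodes of \<open>adv h\<close> lose independent colors, so the expected
  product factors and each factor obeys \<open>palette_potential_supermartingale\<close>.\<close>

lemma load_potential_supermartingale:
  assumes h: "h \<in> set_pmf (run t)" "t < n" and N: "N \<subseteq> U" and gap: "\<Delta> + 2 \<le> real (card C)" and s: "0 < s"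
  shows "(\<integral>\<^sup>+r. (\<Prod>u\<in>N. ennreal (palette_potential s K (palette C (r # h) u))) \<partial>arrival h)
           \<le> (\<Prod>u\<in>N. ennreal (palette_potential s K (palette C h u)))"
proof -
  let ?pot = "\<lambda>P. ennreal (palette_potential s K P)"
  let ?Pi = "Pi_pmf (adv h) 0 (\<lambda>u. pmf_of_set (palette C h u))"
  \<comment> \<open>The factor 1 for arriving neighbors outside \<open>N\<close> lets the product
    range over \<open>adv h\<close>, the index set of the independent picks.\<close>
  define f where "f u c = (if u \<in> N then ?pot (palette C h u - {c}) else 1)" for u c
  have finN: "finite N" using N finite_U finite_subset by metis
  note fin = finite_adv[OF h]
  have split: "(\<Prod>u\<in>N. if u \<in> adv h then F u else G u)
      = (\<Prod>u\<in>N - adv h. G u) * (\<Prod>u\<in>adv h. if u \<in> N then F u else 1)" for F G :: "'u \<Rightarrow> ennreal"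
  proof -
    have "(\<Prod>u\<in>N. if u \<in> adv h then F u else G u) = (\<Prod>u\<in>N \<inter> adv h. F u) * (\<Prod>u\<in>N - adv h. G u)"
      using finN by (simp add: prod.If_cases Diff_eq)
    also have "(\<Prod>u\<in>N \<inter> adv h. F u) = (\<Prod>u\<in>adv h. if u \<in> N then F u else 1)"
      using fin by (simp add: prod.If_cases Int_commute)
    finally show ?thesis by (simp add: mult.commute)
  qed
  have "(\<integral>\<^sup>+r. (\<Prod>u\<in>N. ?pot (palette C (r # h) u)) \<partial>arrival h)
      = (\<integral>\<^sup>+r. (\<Prod>u\<in>N - adv h. ?pot (palette C h u)) * (\<Prod>u\<in>adv h. f u ((case r of (N, c, S) \<Rightarrow> c) u)) \<partial>arrival h)"
  proof (intro nn_integral_cong_AE AE_pmfI)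
    fix r assume r: "r \<in> set_pmf (arrival h)"
    obtain c S where rr: "r = (adv h, c, S)"
      using fst_arrival_pmf[OF r] by (cases r) auto
    have "(\<Prod>u\<in>N. ?pot (palette C (r # h) u))
        = (\<Prod>u\<in>N. if u \<in> adv h then ?pot (palette C h u - {c u}) else ?pot (palette C h u))"
      by (intro prod.cong) (auto simp: rr)
    then show "(\<Prod>u\<in>N. ?pot (palette C (r # h) u))
        = (\<Prod>u\<in>N - adv h. ?pot (palette C h u)) * (\<Prod>u\<in>adv h. f u ((case r of (N, c, S) \<Rightarrow> c) u))"
      unfolding split by (simp add: rr f_def)
  qed
  also have "\<dots> = (\<Prod>u\<in>N - adv h. ?pot (palette C h u)) *
      (\<integral>\<^sup>+r. (\<Prod>u\<in>adv h. f u ((case r of (N, c, S) \<Rightarrow> c) u)) \<partial>arrival h)"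
    by (rule nn_integral_cmult) simp
  also have "(\<integral>\<^sup>+r. (\<Prod>u\<in>adv h. f u ((case r of (N, c, S) \<Rightarrow> c) u)) \<partial>arrival h)
      = (\<integral>\<^sup>+c. (\<Prod>u\<in>adv h. f u (c u)) \<partial>?Pi)"
    unfolding map_choices_arrival_pmf[of crs C adv h, symmetric] by simp
  also have "\<dots> = (\<Prod>u\<in>adv h. \<integral>\<^sup>+c. f u c \<partial>pmf_of_set (palette C h u))"
    by (rule nn_integral_prod_Pi_pmf[OF fin])
  also have "\<dots> \<le> (\<Prod>u\<in>adv h. if u \<in> N then ?pot (palette C h u) else 1)"
  proof (rule prod_mono_ennreal)
    fix u assume u: "u \<in> adv h"
    show "(\<integral>\<^sup>+c. f u c \<partial>pmf_of_set (palette C h u)) \<le> (if u \<in> N then ?pot (palette C h u) else 1)"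
    proof (cases "u \<in> N")
      case True
      have "3 \<le> card (palette C h u)"
        using card_palette_adv[OF h u] gap by linarith
      then show ?thesis
        using palette_potential_supermartingale[OF finite_palette _ s] True by (simp add: f_def)
    qed (simp add: f_def)
  qed
  finally have "(\<integral>\<^sup>+r. (\<Prod>u\<in>N. ?pot (palette C (r # h) u)) \<partial>arrival h)
      \<le> (\<Prod>u\<in>N - adv h. ?pot (palette C h u)) * (\<Prod>u\<in>adv h. if u \<in> N then ?pot (palette C h u) else 1)"
    by (simp add: mult_left_mono)
  also have "\<dots> = (\<Prod>u\<in>N. ?pot (palette C h u))"
    unfolding split[symmetric] by (intro prod.cong) auto
  finally show ?thesis .
qed

text \<open>Chernoff bound from the product potential. Palettes never have fewer than
  \<open>real (card C) - \<Delta>\<close> colors, which bounds the correction terms.\<close>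

lemma prob_heavy_set_le:
  assumes t: "t \<le> n" and N: "N \<subseteq> U" and K: "K \<subseteq> C"
    and gap: "\<Delta> + 2 \<le> real (card C)" and s: "0 < s"
  shows "measure_pmf.prob (run t)
           {h. x \<le> (\<Sum>u\<in>N. real (card (K \<inter> palette C h u)) / real (card (palette C h u)))}
         \<le> exp (real (card N) * (s * (real (card K) / real (card C)) + s\<^sup>2 / (8 * (real (card C) - \<Delta> - 1))) - s * x)"
proof -
  let ?g = "real (card C) - \<Delta> - 1"
  define \<Phi> where "\<Phi> h = (\<Prod>u\<in>N. ennreal (palette_potential s K (palette C h u)))" for h
  have finN: "finite N" using N finite_U finite_subset by metis
  have \<Phi>: "\<Phi> h = ennreal (exp (\<Sum>u\<in>N. s * (real (card (K \<inter> palette C h u)) / real (card (palette C h u)))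
      - s\<^sup>2 / (8 * (real (card (palette C h u)) - 1))))" for h
    unfolding \<Phi>_def palette_potential_def using finN by (simp add: exp_sum prod_ennreal)
  have "(\<integral>\<^sup>+h. \<Phi> h \<partial>run t) \<le> \<Phi> []"
    unfolding \<Phi>_def using load_potential_supermartingale[OF _ _ N gap s] t
    by (intro nn_integral_run_le_initial) auto
  also have "\<Phi> [] \<le> ennreal (exp (real (card N) * (s * (real (card K) / real (card C)))))"
  proof -
    have "K \<inter> C = K" using K by auto
    moreover have "0 \<le> s\<^sup>2 / (8 * (real (card C) - 1))"
      using gap Delta_nonneg by simp
    ultimately have "(\<Sum>u\<in>N. s * (real (card (K \<inter> palette C [] u)) / real (card (palette C [] u)))
      - s\<^sup>2 / (8 * (real (card (palette C [] u)) - 1))) \<le> (\<Sum>u\<in>N. s * (real (card K) / real (card C)))"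
      by (intro sum_mono) simp
    then show ?thesis unfolding \<Phi> by (intro ennreal_leI) simp
  qed
  finally have "(\<integral>\<^sup>+h. \<Phi> h \<partial>run t) \<le> ennreal (exp (real (card N) * (s * (real (card K) / real (card C)))))" .
  moreover have "ennreal (exp (s * x - real (card N) * (s\<^sup>2 / (8 * ?g)))) \<le> \<Phi> h"
    if h: "h \<in> set_pmf (run t)"
      and x: "h \<in> {h. x \<le> (\<Sum>u\<in>N. real (card (K \<inter> palette C h u)) / real (card (palette C h u)))}" for h
  proof -
    have "s * x - real (card N) * (s\<^sup>2 / (8 * ?g)) \<le>
      (\<Sum>u\<in>N. s * (real (card (K \<inter> palette C h u)) / real (card (palette C h u))) - s\<^sup>2 / (8 * ?g))"
      using x s unfolding sum_subtractf sum_distrib_left[symmetric] by simp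
    also have "\<dots> \<le> (\<Sum>u\<in>N. s * (real (card (K \<inter> palette C h u)) / real (card (palette C h u)))
      - s\<^sup>2 / (8 * (real (card (palette C h u)) - 1)))"
    proof (intro sum_mono diff_left_mono divide_left_mono mult_left_mono)
      fix u assume "u \<in> N"
      then have "?g \<le> real (card (palette C h u)) - 1"
        using card_palette[OF h t] N by force
      then show "?g \<le> real (card (palette C h u)) - 1"
        "0 < 8 * (real (card (palette C h u)) - 1) * (8 * ?g)"
        using gap by simp_all
    qed auto
    finally show ?thesis unfolding \<Phi> by (intro ennreal_leI) simp
  qed
  ultimately have "measure_pmf.prob (run t)
      {h. x \<le> (\<Sum>u\<in>N. real (card (K \<inter> palette C h u)) / real (card (palette C h u)))}
    \<le> exp (real (card N) * (s * (real (card K) / real (card C))) - (s * x - real (card N) * (s\<^sup>2 / (8 * ?g))))"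
    by (rule prob_le_exp_Markov[rotated])
  then show ?thesis by (simp add: algebra_simps)
qed

lemma sum_load:
  assumes "finite K"
  shows "(\<Sum>k\<in>K. load h k)
     = (\<Sum>u\<in>adv h. real (card (K \<inter> palette C h u)) / real (card (palette C h u)))"
proof -
  have "(\<Sum>k\<in>K. load h k) = (\<Sum>u\<in>adv h. \<Sum>k\<in>K. marginal C h k u)"
    unfolding load_def by (rule sum.swap)
  also have "\<dots> = (\<Sum>u\<in>adv h. real (card (K \<inter> palette C h u)) / real (card (palette C h u)))"
    unfolding marginal_def sum_divide_distrib[symmetric] of_bool_def
    using assms by (simp add: sum.If_cases)
  finally show ?thesis by simp
qed

text \<open>If \<open>m\<close> colors are overloaded, they form with the next neighborhood a pair
  \<open>(N, K)\<close> of total load at least \<open>m\<close>. The adversary may aim at any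
  \<open>N\<close>, so the union bound runs over all pairs, which are counted crudely.\<close>

lemma prob_overloaded_colors_le:
  assumes t: "t < n" and gap: "\<Delta> + 2 \<le> real (card C)" and s: "0 < s" and m: "0 < m"
  shows "measure_pmf.prob (run t) {h. m \<le> card (overloaded_colors h)}
     \<le> real (card U) ^ nat \<lfloor>\<Delta>\<rfloor> * 2 ^ card C *
        exp (\<Delta> * (s * (real m / real (card C)) + s\<^sup>2 / (8 * (real (card C) - \<Delta> - 1))) - s * real m)"
    (is "_ \<le> _ * _ * ?\<delta>")
proof -
  define \<N> where "\<N> = {N. N \<subseteq> U \<and> N \<noteq> {} \<and> card N \<le> nat \<lfloor>\<Delta>\<rfloor>}"
  define \<K> where "\<K> = {K. K \<subseteq> C \<and> card K = m}"
  define E where "E N K = {h. real m \<le>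
    (\<Sum>u\<in>N. real (card (K \<inter> palette C h u)) / real (card (palette C h u)))}" for N :: "'u set" and K
  have fin: "finite \<N>" "finite \<K>"
    unfolding \<N>_def \<K>_def using finite_U finite_C by auto
  have "measure_pmf.prob (run t) {h. m \<le> card (overloaded_colors h)}
      = measure_pmf.prob (run t) ({h. m \<le> card (overloaded_colors h)} \<inter> set_pmf (run t))"
    by (simp add: measure_Int_set_pmf)
  also have "\<dots> \<le> measure_pmf.prob (run t) (\<Union>(N, K)\<in>\<N> \<times> \<K>. E N K)"
  proof (intro measure_pmf.finite_measure_mono subsetI)
    fix h assume "h \<in> {h. m \<le> card (overloaded_colors h)} \<inter> set_pmf (run t)"
    then have over: "m \<le> card (overloaded_colors h)" and h: "h \<in> set_pmf (run t)" by auto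
    obtain K where K: "K \<subseteq> overloaded_colors h" "card K = m"
      using obtain_subset_with_card_n[OF over] by metis
    have finK: "finite K" using K(1) finite_overloaded_colors finite_subset by metis
    have "real m = (\<Sum>k\<in>K. 1)" using K(2) by simp
    also have "\<dots> \<le> (\<Sum>k\<in>K. load h k)"
      using K(1) by (intro sum_mono) (auto simp: overloaded_colors_def)
    finally have "h \<in> E (adv h) K"
      by (simp add: E_def sum_load[OF finK])
    moreover have "adv h \<noteq> {}"
    proof
      assume "adv h = {}"
      then have "overloaded_colors h = {}" by (simp add: overloaded_colors_def load_def)
      then show False using over m by simp
    qed
    then have "adv h \<in> \<N>"
      using run_adv(1,2)[OF h t] Delta_nonneg by (auto simp: \<N>_def le_nat_floor)
    moreover have "K \<in> \<K>" using K by (auto simp: \<K>_def overloaded_colors_def)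
    ultimately show "h \<in> (\<Union>(N, K)\<in>\<N> \<times> \<K>. E N K)" by blast
  qed auto
  also have "\<dots> \<le> (\<Sum>(N, K)\<in>\<N> \<times> \<K>. measure_pmf.prob (run t) (E N K))"
    using measure_pmf.finite_measure_subadditive_finite[of "\<N> \<times> \<K>" "\<lambda>(N, K). E N K" "run t"] fin
    by (simp add: case_prod_unfold)
  also have "\<dots> \<le> (\<Sum>(N, K)\<in>\<N> \<times> \<K>. ?\<delta>)"
  proof (intro sum_mono, clarify)
    fix N K assume NK: "N \<in> \<N>" "K \<in> \<K>"
    then have d: "real (card N) \<le> \<Delta>" using Delta_nonneg by (simp add: \<N>_def le_nat_iff le_floor_iff)
    have "measure_pmf.prob (run t) (E N K)
      \<le> exp (real (card N) * (s * (real (card K) / real (card C)) + s\<^sup>2 / (8 * (real (card C) - \<Delta> - 1))) - s * real m)"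
      unfolding E_def using NK t by (intro prob_heavy_set_le gap s) (auto simp: \<N>_def \<K>_def)
    also have "\<dots> \<le> ?\<delta>"
    proof -
      have "0 \<le> s * (real m / real (card C)) + s\<^sup>2 / (8 * (real (card C) - \<Delta> - 1))"
        using s gap by simp
      then show ?thesis using NK(2) d by (simp add: \<K>_def mult_right_mono)
    qed
    finally show "measure_pmf.prob (run t) (E N K) \<le> ?\<delta>" .
  qed
  also have "\<dots> = real (card \<N>) * real (card \<K>) * ?\<delta>"
    by (simp add: card_cartesian_product)
  also have "\<dots> \<le> real (card U) ^ nat \<lfloor>\<Delta>\<rfloor> * 2 ^ card C * ?\<delta>"
  proof (intro mult_mono)
    show "real (card \<N>) \<le> real (card U) ^ nat \<lfloor>\<Delta>\<rfloor>"
      using card_nonempty_subsets_le[OF finite_U, of "nat \<lfloor>\<Delta>\<rfloor>"] unfolding \<N>_def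
      by (metis of_nat_le_iff of_nat_power)
    have "card \<K> \<le> card (Pow C)"
      using finite_C by (intro card_mono) (auto simp: \<K>_def)
    then show "real (card \<K>) \<le> 2 ^ card C"
      using finite_C by (simp add: card_Pow flip: of_nat_le_iff)
  qed auto
  finally show ?thesis .
qed

section \<open>Concentration of uncolored degrees\<close>

text \<open>Every history strictly before the current one is tested, that is, each neighborhood that
  has already arrived; the one arriving next is left open.\<close>

primrec controlled :: "nat \<Rightarrow> 'u history \<Rightarrow> bool" where
  "controlled m [] \<longleftrightarrow> True"
| "controlled m (r # h) \<longleftrightarrow> card (overloaded_colors h) < m \<and> controlled m h"

lemma prob_not_controlled_le:
  assumes \<delta>: "\<And>i. i < n \<Longrightarrow> measure_pmf.prob (run i) {h. m \<le> card (overloaded_colors h)} \<le> \<delta>" and t: "t \<le> n"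
  shows "measure_pmf.prob (run t) {h. \<not> controlled m h} \<le> real t * \<delta>"
  using t
proof (induction t)
  case (Suc t)
  let ?B = "{h. \<not> controlled m h} \<union> {h. m \<le> card (overloaded_colors h)}"
  \<comment> \<open>Control after an arrival is decided by the history before it, so a good past
    leaves failure probability 0.\<close>
  have "measure_pmf.prob (run (Suc t)) {h. \<not> controlled m h} \<le> measure_pmf.prob (run t) ?B + 0"
    by (rule prob_run_Suc_le) auto
  also have "\<dots> \<le> measure_pmf.prob (run t) {h. \<not> controlled m h}
      + measure_pmf.prob (run t) {h. m \<le> card (overloaded_colors h)}"
    using measure_Un_le[of "{h. \<not> controlled m h}" "run t" "{h. m \<le> card (overloaded_colors h)}"] by simp
  also have "\<dots> \<le> real t * \<delta> + \<delta>"
    using Suc \<delta>[of t] by (intro add_mono) auto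
  finally show ?case by (simp add: algebra_simps)
qed simp

lemma prob_uncolored_le_of_gap:
  assumes h: "h \<in> set_pmf (run t)" "t < n" and u: "u \<in> adv h"
    and over: "card (overloaded_colors h) \<le> m" and gap: "\<Delta> < real (card C)"
  shows "measure_pmf.prob (arrival h) {(N, c, S). u \<notin> (\<Union>k. S k)}
           \<le> exp (- 1) + real m / (real (card C) - \<Delta>)"
proof -
  have "real (card (overloaded_colors h)) / real (card (palette C h u)) \<le> real m / (real (card C) - \<Delta>)"
    using over gap card_palette_adv[OF h u] by (intro frac_le) auto
  then show ?thesis using prob_uncolored_le[OF h u] by linarith
qed

text \<open>Colors are irrevocable, so only the newest online node can add a violation. Either fewer
  than \<open>m\<close> colors were overloaded and \<open>prob_uncolored_online_le\<close> applies,
  or the new history is not controlled.\<close>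

lemma prob_controlled_online_le:
  assumes \<mu>: "\<And>i h u. i < n \<Longrightarrow> h \<in> set_pmf (run i) \<Longrightarrow> u \<in> adv h \<Longrightarrow> card (overloaded_colors h) < m \<Longrightarrow>
      measure_pmf.prob (arrival h) {(N, c, S). u \<notin> (\<Union>k. S k)} \<le> \<mu>"
    and \<mu>0: "0 \<le> \<mu>" and s: "0 < s" and t: "t \<le> n"
  shows "measure_pmf.prob (run t) {h. controlled m h \<and>
            (\<exists>j\<in>{1..t}. x < real (card {u. (u, j) \<in> graph_edges h - colored_edges h}))}
          \<le> real t * exp ((s * \<mu> + s\<^sup>2 / 8) * \<Delta> - s * x)"
  using t
proof (induction t)
  case (Suc t)
  define A where "A t = {h. controlled m h \<and>
    (\<exists>j\<in>{1..t}. x < real (card {u. (u, j) \<in> graph_edges h - colored_edges h}))}" for t :: nat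
  have t: "t < n" using Suc.prems by simp
  have "measure_pmf.prob (run (Suc t)) (A (Suc t))
      \<le> measure_pmf.prob (run t) (A t) + exp ((s * \<mu> + s\<^sup>2 / 8) * \<Delta> - s * x)"
  proof (rule prob_run_Suc_le)
    fix h assume h: "h \<in> set_pmf (run t)" and hA: "h \<notin> A t"
    have len: "length h = t" by (rule length_run_arrivals[OF h])
    have sub: "{r. r # h \<in> A (Suc t)} \<subseteq> {(N, c, S). x < real (card (N - (\<Union>k. S k)))}"
    proof (clarsimp)
      fix N c S assume "(N, c, S) # h \<in> A (Suc t)"
      then obtain j where j: "j \<in> {1..Suc t}" "controlled m h"
        "x < real (card {u. (u, j) \<in> graph_edges ((N, c, S) # h) - colored_edges ((N, c, S) # h)})"
        unfolding A_def by auto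
      have "j = Suc t"
      proof (rule ccontr)
        assume "j \<noteq> Suc t"
        then have "j \<in> {1..t}" "j \<le> length h" using j(1) len by auto
        then show False using j(2,3) hA unfolding A_def uncolored_at_earlier[OF \<open>j \<le> length h\<close>] by blast
      qed
      then show "x < real (card (N - (\<Union>k. S k)))"
        using j(3) uncolored_at_last[of h N c S] len by simp
    qed
    show "measure_pmf.prob (arrival h) {r. r # h \<in> A (Suc t)} \<le> exp ((s * \<mu> + s\<^sup>2 / 8) * \<Delta> - s * x)"
    proof (cases "card (overloaded_colors h) < m")
      case True
      have "measure_pmf.prob (arrival h) {r. r # h \<in> A (Suc t)}
          \<le> measure_pmf.prob (arrival h) {(N, c, S). x < real (card (N - (\<Union>k. S k)))}"
        using sub by (intro measure_pmf.finite_measure_mono) auto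
      also have "\<dots> \<le> exp ((s * \<mu> + s\<^sup>2 / 8) * real (card (adv h)) - s * x)"
        by (rule prob_uncolored_online_le[OF h t s]) (rule \<mu>[OF t h _ True])
      also have "\<dots> \<le> exp ((s * \<mu> + s\<^sup>2 / 8) * \<Delta> - s * x)"
        using run_adv(2)[OF h t] s \<mu>0 by (simp add: mult_left_mono)
      finally show ?thesis .
    next
      case False
      then have "{r. r # h \<in> A (Suc t)} = {}" by (auto simp: A_def)
      then show ?thesis by (simp only: measure_empty exp_ge_zero)
    qed
  qed simp
  also have "measure_pmf.prob (run t) (A t) \<le> real t * exp ((s * \<mu> + s\<^sup>2 / 8) * \<Delta> - s * x)"
    unfolding A_def using Suc by simp
  finally show ?case unfolding A_def by (simp add: algebra_simps)
qed simp

text \<open>The compensator \<open>\<nu>\<close> is charged per edge at \<open>u\<close> and not per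
  arrival, so the exponent scales with \<open>\<Delta>\<close> instead of \<open>n\<close>.\<close>

lemma prob_controlled_offline_le:
  assumes \<mu>: "\<And>i h u. i < n \<Longrightarrow> h \<in> set_pmf (run i) \<Longrightarrow> u \<in> adv h \<Longrightarrow> card (overloaded_colors h) < m \<Longrightarrow>
      measure_pmf.prob (arrival h) {(N, c, S). u \<notin> (\<Union>k. S k)} \<le> \<mu>"
    and \<mu>0: "0 \<le> \<mu>" and s: "0 < s" and u: "u \<in> U"
  shows "measure_pmf.prob (run n) {h. controlled m h \<and> x < real (uncolored_degree h u)}
          \<le> exp ((s * \<mu> + s\<^sup>2 / 8) * \<Delta> - s * x)"
proof -
  define \<nu> where "\<nu> = s * \<mu> + s\<^sup>2 / 8"
  have \<nu>: "0 \<le> \<nu>" using s \<mu>0 by (simp add: \<nu>_def)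
  \<comment> \<open>The potential drops to 0 once control is lost, so the supermartingale step only
    concerns histories where the bound \<open>\<mu>\<close> applies.\<close>
  define \<Psi> where "\<Psi> h = (if controlled m h
    then ennreal (exp (s * real (uncolored_degree h u) - \<nu> * real (degree h u))) else 0)" for h
  have step: "(\<integral>\<^sup>+r. \<Psi> (r # h) \<partial>arrival h) \<le> \<Psi> h" if i: "i < n" and h: "h \<in> set_pmf (run i)" for i h
  proof (cases "controlled m h \<and> card (overloaded_colors h) < m")
    case False
    then have "\<Psi> (r # h) = 0" for r by (auto simp: \<Psi>_def)
    then show ?thesis by simp
  next
    case True
    let ?unc = "{(N, c, S). u \<notin> (\<Union>k. S k)}"
    have rec: "\<Psi> (r # h) = \<Psi> h * (if u \<in> adv h
        then ennreal (exp (s * indicator ?unc r)) * ennreal (exp (- \<nu>)) else 1)"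
      if r: "r \<in> set_pmf (arrival h)" for r
    proof -
      obtain c S where rr: "r = (adv h, c, S)"
        using fst_arrival_pmf[OF r] by (cases r) auto
      show ?thesis using True
        by (auto simp: rr \<Psi>_def uncolored_degree_Cons degree_Cons algebra_simps
            simp flip: ennreal_mult exp_add)
    qed
    show ?thesis
    proof (cases "u \<in> adv h")
      case False
      have "(\<integral>\<^sup>+r. \<Psi> (r # h) \<partial>arrival h) = (\<integral>\<^sup>+r. \<Psi> h \<partial>arrival h)"
        using rec False by (intro nn_integral_cong_AE AE_pmfI) simp
      then show ?thesis by simp
    next
      case uh: True
      have "(\<integral>\<^sup>+r. \<Psi> (r # h) \<partial>arrival h)
          = (\<integral>\<^sup>+r. \<Psi> h * ennreal (exp (- \<nu>)) * ennreal (exp (s * indicator ?unc r)) \<partial>arrival h)"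
        using rec uh by (intro nn_integral_cong_AE AE_pmfI) (simp add: ac_simps)
      also have "\<dots> = \<Psi> h * ennreal (exp (- \<nu>)) * (\<integral>\<^sup>+r. ennreal (exp (s * indicator ?unc r)) \<partial>arrival h)"
        by (rule nn_integral_cmult) simp
      also have "(\<integral>\<^sup>+r. ennreal (exp (s * indicator ?unc r)) \<partial>arrival h)
          \<le> ennreal (exp (s * measure_pmf.expectation (arrival h) (indicator ?unc) + s\<^sup>2 * (1 - 0)\<^sup>2 / 8))"
        by (rule nn_integral_exp_le_Hoeffding[OF _ s]) (simp add: indicator_def)
      also have "\<dots> \<le> ennreal (exp \<nu>)"
        using \<mu>[OF i h uh] True s by (intro ennreal_leI) (simp add: \<nu>_def)
      also have "\<Psi> h * ennreal (exp (- \<nu>)) * ennreal (exp \<nu>) = \<Psi> h"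
        by (simp add: mult.assoc flip: ennreal_mult exp_add)
      finally show ?thesis by (simp add: mult_left_mono)
    qed
  qed
  have "(\<integral>\<^sup>+h. \<Psi> h \<partial>run n) \<le> \<Psi> []"
    by (rule nn_integral_run_le_initial[OF step]) auto
  then have "(\<integral>\<^sup>+h. \<Psi> h \<partial>run n) \<le> ennreal (exp 0)" by (simp add: \<Psi>_def)
  moreover have "ennreal (exp (s * x - \<nu> * \<Delta>)) \<le> \<Psi> h"
    if h: "h \<in> set_pmf (run n)" and hx: "h \<in> {h. controlled m h \<and> x < real (uncolored_degree h u)}" for h
  proof -
    have "s * x \<le> s * real (uncolored_degree h u)" "\<nu> * real (degree h u) \<le> \<nu> * \<Delta>"
      using hx s \<nu> run_edges(2)[OF h _ u] by (auto intro!: mult_left_mono)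
    then show ?thesis using hx by (simp add: \<Psi>_def ennreal_leI)
  qed
  ultimately have "measure_pmf.prob (run n) {h. controlled m h \<and> x < real (uncolored_degree h u)}
      \<le> exp (0 - (s * x - \<nu> * \<Delta>))"
    by (rule prob_le_exp_Markov[rotated])
  then show ?thesis by (simp add: \<nu>_def)
qed

text \<open>Three failures are added up: loss of control and some bad online node, each at most
  \<open>n * \<delta>\<close>, and some bad offline node, at most \<open>card U * \<delta>\<close>.
  The parameter \<open>s\<close> serves the loads, \<open>s'\<close> the uncolored degrees.\<close>

lemma prob_uncolored_max_degree_ge:
  assumes gap: "\<Delta> + 2 \<le> real (card C)" and m: "0 < m" and s: "0 < s" and s': "0 < s'" and x: "0 \<le> x"
    and \<mu>: "exp (- 1) + real m / (real (card C) - \<Delta>) \<le> \<mu>"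
    and \<delta>: "real (card U) ^ nat \<lfloor>\<Delta>\<rfloor> * 2 ^ card C *
        exp (\<Delta> * (s * (real m / real (card C)) + s\<^sup>2 / (8 * (real (card C) - \<Delta> - 1))) - s * real m) \<le> \<delta>"
    and \<delta>': "exp ((s' * \<mu> + s'\<^sup>2 / 8) * \<Delta> - s' * x) \<le> \<delta>"
  shows "1 - real (2 * n + card U) * \<delta>
     \<le> measure_pmf.prob (run n) {h. real (max_degree U n (graph_edges h - colored_edges h)) \<le> x}"
    (is "_ \<le> measure_pmf.prob _ ?G")
proof -
  have "0 \<le> real m / (real (card C) - \<Delta>)" using gap by simp
  then have \<mu>0: "0 \<le> \<mu>" using \<mu> exp_gt_zero[of "- 1 :: real"] by linarith
  have unc: "measure_pmf.prob (arrival h) {(N, c, S). u \<notin> (\<Union>k. S k)} \<le> \<mu>"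
    if "i < n" "h \<in> set_pmf (run i)" "u \<in> adv h" "card (overloaded_colors h) < m" for i h u
    using prob_uncolored_le_of_gap[OF that(2,1,3), of m] that(4) gap \<mu> by simp
  let ?B1 = "{h. \<not> controlled m h}"
  let ?B2 = "{h. controlled m h \<and>
    (\<exists>j\<in>{1..n}. x < real (card {u. (u, j) \<in> graph_edges h - colored_edges h}))}"
  let ?B3 = "\<lambda>u. {h. controlled m h \<and> x < real (uncolored_degree h u)}"
  have B1: "measure_pmf.prob (run n) ?B1 \<le> real n * \<delta>"
    using prob_overloaded_colors_le[OF _ gap s m] \<delta> by (intro prob_not_controlled_le) (auto intro: order_trans)
  have "measure_pmf.prob (run n) ?B2 \<le> real n * exp ((s' * \<mu> + s'\<^sup>2 / 8) * \<Delta> - s' * x)"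
    by (rule prob_controlled_online_le[OF unc \<mu>0 s' order_refl])
  also have "\<dots> \<le> real n * \<delta>" using \<delta>' by (intro mult_left_mono) auto
  finally have B2: "measure_pmf.prob (run n) ?B2 \<le> real n * \<delta>" .
  have "measure_pmf.prob (run n) (\<Union>u\<in>U. ?B3 u) \<le> (\<Sum>u\<in>U. measure_pmf.prob (run n) (?B3 u))"
    using finite_U by (intro measure_pmf.finite_measure_subadditive_finite) auto
  also have "\<dots> \<le> (\<Sum>u\<in>U. \<delta>)"
    using order_trans[OF prob_controlled_offline_le[OF unc \<mu>0 s'] \<delta>'] by (intro sum_mono) auto
  finally have B3: "measure_pmf.prob (run n) (\<Union>u\<in>U. ?B3 u) \<le> real (card U) * \<delta>" by simp
  have "1 - measure_pmf.prob (run n) ?G = measure_pmf.prob (run n) (- ?G)"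
    using measure_pmf.prob_compl[of ?G "run n"] by (simp add: Compl_eq_Diff_UNIV)
  also have "\<dots> \<le> measure_pmf.prob (run n) (?B1 \<union> ?B2 \<union> (\<Union>u\<in>U. ?B3 u))"
    by (intro measure_pmf.finite_measure_mono)
      (auto simp: real_max_degree_le_iff[OF finite_U x] uncolored_degree_def not_le)
  also have "\<dots> \<le> measure_pmf.prob (run n) (?B1 \<union> ?B2) + measure_pmf.prob (run n) (\<Union>u\<in>U. ?B3 u)"
    by (rule measure_Un_le) auto
  also have "measure_pmf.prob (run n) (?B1 \<union> ?B2)
      \<le> measure_pmf.prob (run n) ?B1 + measure_pmf.prob (run n) ?B2"
    by (rule measure_Un_le) auto
  finally show ?thesis using B1 B2 B3 by (simp add: algebra_simps)
qed

end

section \<open>Choice of parameters\<close>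

lemma eps_power5:
  assumes "0 \<le> ln (real n)" "0 < \<Delta>"
  shows "eps n \<Delta> ^ 5 = 32 * ln (real n) / \<Delta>"
proof -
  have "root 5 (ln (real n) / \<Delta>) ^ 5 = ln (real n) / \<Delta>"
    using assms by (intro real_root_pow_pos2) auto
  then show ?thesis by (simp add: eps_def power_mult_distrib)
qed

text \<open>Here \<open>q\<close> is \<open>\<surd>\<epsilon>\<close>, \<open>L\<close> is
  \<open>ln n\<close>, \<open>c\<close> the number of colors and \<open>m\<close> is
  \<open>\<epsilon>\<Delta>\<close> rounded up. The last bound says that the tail of the load pays
  for the union bound and still leaves \<open>exp (- 8 * L)\<close>.\<close>

lemma parameter_bounds:
  fixes q \<Delta> L c :: real
  assumes q: "0 < q" "q \<le> 1" and L: "1 / 2 \<le> L" and qL: "\<Delta> * q ^ 10 = 32 * L"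
    and c: "(1 + q) * \<Delta> \<le> c" "c \<le> (1 + q) * \<Delta> + 1" and m: "q\<^sup>2 * \<Delta> \<le> m" "m \<le> q\<^sup>2 * \<Delta> + 1"
  shows "\<Delta> + 2 \<le> c" and "0 < m" and "m / (c - \<Delta>) \<le> 2 * q" and "32 * L \<le> q\<^sup>2 * \<Delta>"
    and "\<Delta> * ((m * q\<^sup>2) * (m / c) + (m * q\<^sup>2)\<^sup>2 / (8 * (c - \<Delta> - 1))) - (m * q\<^sup>2) * m
           \<le> - 8 * L - \<Delta> * L - c * L"
proof -
  have \<Delta>: "0 < \<Delta>"
    using qL L q by (metis mult_pos_pos zero_less_mult_pos2 zero_less_numeral zero_less_power
        order_less_le_trans half_gt_zero zero_less_one)
  \<comment> \<open>As \<open>q \<le> 1\<close>, the equation for \<open>q ^ 10\<close> yields the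
    same lower bound for all smaller powers; the powers 0, 1, 2 and 7 are used.\<close>
  have pow: "32 * L \<le> q ^ k * \<Delta>" if "k \<le> 10" for k
  proof -
    have "32 * L = q ^ 10 * \<Delta>" using qL by (simp add: mult.commute)
    also have "\<dots> \<le> q ^ k * \<Delta>"
      using q \<Delta> that by (intro mult_right_mono power_decreasing) auto
    finally show ?thesis .
  qed
  have q1: "16 \<le> q * \<Delta>" using pow[of 1] L by simp
  show q2: "32 * L \<le> q\<^sup>2 * \<Delta>" using pow[of 2] by simp
  have \<Delta>16: "16 \<le> \<Delta>" using pow[of 0] L by simp
  have cq: "q * \<Delta> \<le> c - \<Delta>" using c(1) by (simp add: algebra_simps)
  show "\<Delta> + 2 \<le> c" using cq q1 by simp
  show m0: "0 < m" using m(1) q2 L by linarith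
  have "m / (c - \<Delta>) \<le> (2 * (q\<^sup>2 * \<Delta>)) / (q * \<Delta>)"
    by (intro frac_le; use m q2 L cq q1 in linarith)
  also have "\<dots> = 2 * q" using q \<Delta> by (simp add: power2_eq_square)
  finally show "m / (c - \<Delta>) \<le> 2 * q" .
  \<comment> \<open>This value minimizes \<open>- s * m * q / 2 + s\<^sup>2 / (4 * q)\<close>, the
    sum of the gain from the mean and the variance bound derived below.\<close>
  define s where "s = m * q\<^sup>2"
  have s: "0 < s" using m0 q by (simp add: s_def)
  \<comment> \<open>The surplus of colors keeps the expected total load below \<open>m\<close> by at
    least \<open>m * q / 2\<close>.\<close>
  have "\<Delta> * (m / c) \<le> m - m * q / 2"
  proof -
    have "\<Delta> / c \<le> 1 / (1 + q)"
      using c(1) q \<Delta> \<open>\<Delta> + 2 \<le> c\<close> by (simp add: field_simps)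
    also have "\<dots> \<le> 1 - q / 2"
    proof -
      have "q * q \<le> q * 1" using q by (intro mult_left_mono) auto
      then show ?thesis using q by (simp add: field_simps)
    qed
    finally have "m * (\<Delta> / c) \<le> m * (1 - q / 2)"
      using m0 by (intro mult_left_mono) auto
    then show ?thesis by (simp add: algebra_simps)
  qed
  then have "s * (\<Delta> * (m / c)) \<le> s * (m - m * q / 2)"
    using s by (intro mult_left_mono) auto
  moreover have "\<Delta> * (s\<^sup>2 / (8 * (c - \<Delta> - 1))) \<le> s\<^sup>2 / (4 * q)"
  proof -
    have "\<Delta> * (s\<^sup>2 / (8 * (c - \<Delta> - 1))) \<le> \<Delta> * (s\<^sup>2 / (4 * (q * \<Delta>)))"
      using cq q1 q \<Delta> by (intro mult_left_mono divide_left_mono mult_pos_pos) auto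
    also have "\<dots> = s\<^sup>2 / (4 * q)" using \<Delta> q by (simp add: field_simps)
    finally show ?thesis .
  qed
  moreover have "s\<^sup>2 / (4 * q) = m\<^sup>2 * q ^ 3 / 4"
    using q by (simp add: s_def field_simps eval_nat_numeral)
  moreover have "s * (m - m * q / 2) = s * m - m\<^sup>2 * q ^ 3 / 2"
    by (simp add: s_def field_simps eval_nat_numeral)
  \<comment> \<open>The quantity \<open>m\<^sup>2 * q ^ 3 / 4\<close> is what remains of the gain
    after the variance; it has to cover \<open>3 * \<Delta> * L + 9 * L\<close>.\<close>
  moreover have "8 * (\<Delta> * L) \<le> m\<^sup>2 * q ^ 3 / 4"
  proof -
    have "(q\<^sup>2 * \<Delta>)\<^sup>2 * q ^ 3 \<le> m\<^sup>2 * q ^ 3"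
      using m(1) q \<Delta> by (intro mult_right_mono power_mono) auto
    moreover have "(q\<^sup>2 * \<Delta>)\<^sup>2 * q ^ 3 = \<Delta> * (q ^ 7 * \<Delta>)"
      by (simp add: field_simps eval_nat_numeral)
    moreover have "\<Delta> * (32 * L) \<le> \<Delta> * (q ^ 7 * \<Delta>)"
      using pow[of 7] \<Delta> by (intro mult_left_mono) auto
    ultimately show ?thesis by linarith
  qed
  moreover have "c * L \<le> 2 * (\<Delta> * L) + L"
  proof -
    have "c \<le> 2 * \<Delta> + 1" using c(2) mult_right_mono[OF q(2) less_imp_le[OF \<Delta>]] by (simp add: distrib_right)
    then have "c * L \<le> (2 * \<Delta> + 1) * L" using L by (intro mult_right_mono) auto
    then show ?thesis by (simp add: algebra_simps)
  qed
  moreover have "16 * L \<le> \<Delta> * L" using \<Delta>16 L by (intro mult_right_mono) auto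
  ultimately have "s * (\<Delta> * (m / c)) + \<Delta> * (s\<^sup>2 / (8 * (c - \<Delta> - 1))) - s * m \<le> - 8 * L - \<Delta> * L - c * L"
    using L by linarith
  then show "\<Delta> * ((m * q\<^sup>2) * (m / c) + (m * q\<^sup>2)\<^sup>2 / (8 * (c - \<Delta> - 1))) - (m * q\<^sup>2) * m
           \<le> - 8 * L - \<Delta> * L - c * L"
    unfolding s_def[symmetric] by (simp add: algebra_simps)
qed

theorem theorem3p1:
  fixes U :: "'u set" and n :: nat and \<Delta> :: real
    and crs :: "'u set \<Rightarrow> ('u \<Rightarrow> real) \<Rightarrow> 'u set \<Rightarrow> 'u set pmf"
    and adv :: "'u history \<Rightarrow> 'u set"
  assumes "finite U" and "card U = n"
    and "\<Delta> \<ge> 32 * ln (real n)"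
    and "contention_resolution_scheme crs"
    and "\<And>h. h \<in> set_pmf (partial_edge_coloring_alg crs n \<Delta> adv) \<Longrightarrow>
           graph_edges h \<subseteq> U \<times> {1..n} \<and> real (max_degree U n (graph_edges h)) \<le> \<Delta>"
  shows "(\<forall>h \<in> set_pmf (partial_edge_coloring_alg crs n \<Delta> adv).
            proper_partial_edge_coloring (graph_edges h) (color_set n \<Delta>) (color_assignment h)) \<and>
         measure_pmf.prob (partial_edge_coloring_alg crs n \<Delta> adv)
           {h. real (max_degree U n (graph_edges h - colored_edges h))
                 \<le> (exp (- 1) + 3 * sqrt (eps n \<Delta>)) * \<Delta>}
         \<ge> 1 - 1 / real n ^ 5"
proof -
  define C where "C = color_set n \<Delta>"
  define q where "q = sqrt (eps n \<Delta>)"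
  define L where "L = ln (real n)"
  have L0: "0 \<le> L" by (cases "n = 0") (auto simp: L_def)
  then have \<Delta>0: "0 \<le> \<Delta>" using assms(3) by (simp add: L_def)
  have eps0: "0 \<le> eps n \<Delta>" using L0 \<Delta>0 by (simp add: eps_def L_def)
  then have q0: "0 \<le> q" by (simp add: q_def)
  have cardC: "(1 + q) * \<Delta> \<le> real (card C)" "real (card C) \<le> (1 + q) * \<Delta> + 1"
    using q0 \<Delta>0 by (simp_all add: C_def color_set_def flip: q_def)
  interpret online_coloring crs C adv U n \<Delta>
  proof unfold_locales
    show "\<Delta> \<le> real (card C)"
      using cardC(1) mult_right_mono[of 1 "1 + q" \<Delta>] q0 \<Delta>0 by simp
    show "graph_edges h \<subseteq> U \<times> {1..n} \<and> real (max_degree U n (graph_edges h)) \<le> \<Delta>"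
      if "h \<in> set_pmf (run_arrivals crs C adv n)" for h
      using assms(5) that by (simp add: partial_edge_coloring_alg_def C_def)
  qed (use assms in \<open>auto simp: C_def color_set_def\<close>)
  have "1 - 1 / real n ^ 5 \<le> measure_pmf.prob (run n)
      {h. real (max_degree U n (graph_edges h - colored_edges h)) \<le> (exp (- 1) + 3 * q) * \<Delta>}"
  \<comment> \<open>For \<open>n = 1\<close> the claimed lower bound is 0. For \<open>n = 0\<close>
    it is 1 because \<open>1 / 0 = 0\<close>, but then there are no nodes.\<close>
  proof (cases "2 \<le> n")
    case False
    then consider "n = 0" | "n = 1" by linarith
    then show ?thesis
    proof cases
      case 1
      then show ?thesis using assms(1,2) q0 \<Delta>0 by (simp add: max_degree_def)
    qed simp
  next
    case True
    have "ln 2 \<le> L" using True by (simp add: L_def)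
    then have L: "1 / 2 \<le> L" using ln2_ge_two_thirds by linarith
    then have \<Delta>: "0 < \<Delta>" using assms(3) by (simp add: L_def)
    have "q ^ 10 = (q\<^sup>2) ^ 5" by simp
    also have "q\<^sup>2 = eps n \<Delta>" using eps0 by (simp add: q_def)
    also have "eps n \<Delta> ^ 5 = 32 * L / \<Delta>" using eps_power5 L0 \<Delta> by (simp add: L_def)
    finally have q10: "q ^ 10 = 32 * L / \<Delta>" .
    then have qL: "\<Delta> * q ^ 10 = 32 * L" using \<Delta> by simp
    have "q \<noteq> 0" using q10 L \<Delta> by auto
    then have q: "0 < q" using q0 by simp
    \<comment> \<open>The hypothesis \<open>32 * ln n \<le> \<Delta>\<close> says exactly
      this.\<close>
    have "q ^ 10 \<le> 1 ^ 10" using q10 assms(3) \<Delta> by (simp add: L_def)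
    then have q1: "q \<le> 1" using q by (simp add: power_le_one_iff)
    define m where "m = nat \<lceil>q\<^sup>2 * \<Delta>\<rceil>"
    have "0 \<le> q\<^sup>2 * \<Delta>" using \<Delta>0 by simp
    then have m: "q\<^sup>2 * \<Delta> \<le> real m" "real m \<le> q\<^sup>2 * \<Delta> + 1"
      unfolding m_def by linarith+
    note b = parameter_bounds[OF q q1 L qL cardC m]
    have nexp: "real n = exp L" using True by (simp add: L_def)
    have "1 - real (2 * n + card U) * exp (- 8 * L)
      \<le> measure_pmf.prob (run n)
          {h. real (max_degree U n (graph_edges h - colored_edges h)) \<le> (exp (- 1) + 3 * q) * \<Delta>}"
    proof (rule prob_uncolored_max_degree_ge)
      show "\<Delta> + 2 \<le> real (card C)" "0 < m" using b(1,2) by simp_all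
      \<comment> \<open>The mean bound \<open>1/e + 2 * q\<close> and the target
        \<open>1/e + 3 * q\<close> differ by \<open>q\<close>, and \<open>s' = 4 * q\<close>
        minimizes the resulting exponent \<open>s'\<^sup>2 / 8 - s' * q\<close> per unit of
        \<open>\<Delta>\<close>.\<close>
      show "0 < real m * q\<^sup>2" "0 < 4 * q" using b(2) q by simp_all
      show "0 \<le> (exp (- 1) + 3 * q) * \<Delta>" using q \<Delta> by simp
      show "exp (- 1) + real m / (real (card C) - \<Delta>) \<le> exp (- 1) + 2 * q" using b(3) by simp
      have "(4 * q * (exp (- 1) + 2 * q) + (4 * q)\<^sup>2 / 8) * \<Delta> - 4 * q * ((exp (- 1) + 3 * q) * \<Delta>)
          = - 2 * (q\<^sup>2 * \<Delta>)"
        by (simp add: field_simps power2_eq_square)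
      also have "\<dots> \<le> - 8 * L" using b(4) L by linarith
      finally show "exp ((4 * q * (exp (- 1) + 2 * q) + (4 * q)\<^sup>2 / 8) * \<Delta>
          - 4 * q * ((exp (- 1) + 3 * q) * \<Delta>)) \<le> exp (- 8 * L)"
        by simp
      let ?E = "\<Delta> * (real m * q\<^sup>2 * (real m / real (card C))
          + (real m * q\<^sup>2)\<^sup>2 / (8 * (real (card C) - \<Delta> - 1))) - real m * q\<^sup>2 * real m"
      have "real n ^ nat \<lfloor>\<Delta>\<rfloor> = exp (real (nat \<lfloor>\<Delta>\<rfloor>) * L)"
        by (simp add: nexp exp_of_nat_mult)
      also have "\<dots> \<le> exp (\<Delta> * L)" using L0 \<Delta>0 by (simp add: mult_right_mono)
      finally have "real n ^ nat \<lfloor>\<Delta>\<rfloor> * 2 ^ card C * exp ?E \<le> exp (\<Delta> * L) * exp (real (card C) * L) * exp ?E"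
      proof (intro mult_mono)
        \<comment> \<open>Since \<open>2 \<le> n\<close>, the number of color sets can also be
          measured in powers of \<open>n\<close>.\<close>
        have "2 ^ card C \<le> exp L ^ card C" using True by (intro power_mono) (auto simp: nexp[symmetric])
        then show "2 ^ card C \<le> exp (real (card C) * L)" by (simp add: exp_of_nat_mult)
      qed auto
      also have "\<dots> = exp (\<Delta> * L + real (card C) * L + ?E)" by (simp add: exp_add)
      also have "\<dots> \<le> exp (- 8 * L)" using b(5) by simp
      finally show "real (card U) ^ nat \<lfloor>\<Delta>\<rfloor> * 2 ^ card C * exp ?E \<le> exp (- 8 * L)"
        by (simp add: assms(2))
    qed
    \<comment> \<open>The total failure is \<open>3 * n\<close> times the power \<open>-8\<close> of
      \<open>n\<close>, and \<open>3 \<le> n\<^sup>2\<close>.\<close>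
    moreover have "real (2 * n + card U) * exp (- 8 * L) \<le> 1 / real n ^ 5"
    proof -
      have "exp (- 8 * L) = 1 / real n ^ 8"
        by (simp add: nexp exp_minus divide_inverse flip: exp_of_nat_mult)
      moreover have "3 \<le> (real n)\<^sup>2" using power_mono[of 2 "real n" 2] True by simp
      then have "3 * real n ^ 6 \<le> (real n)\<^sup>2 * real n ^ 6" by (intro mult_right_mono) auto
      then have "3 * real n * real n ^ 5 \<le> real n ^ 8" by (simp add: eval_nat_numeral algebra_simps)
      then have "3 * real n / real n ^ 8 \<le> 1 / real n ^ 5" using True by (simp add: field_simps)
      ultimately show ?thesis using assms(2) by simp
    qed
    ultimately show ?thesis by linarith
  qed
  then show ?thesis
    using proper_coloring[of _ n] by (simp add: partial_edge_coloring_alg_def C_def q_def)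
qed

end
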